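(* Assume $\mathcal I\neq\emptyset$ and let $\mathcal M=\mathcal M(A,B)\subset{}^d\mathcal K$ be maximal isotropic. Then $$-\Delta(\mathcal M,\underline a)\ \geq\ -s(\|L_+\|)^2,$$ where $L_+$ is the positive part of the self-adjoint operator $L$ and $s(t)$ is the unique nonnegative solution $s$ of the equation $s\tanh\left(\frac{as}{2}\right)=t$, with $a=\min_{i\in\mathcal I}a_i$.
   Context: Let $\mathcal G=(V,\mathcal I,\mathcal E,\partial)$ be a finite connected graph: $V$ a finite set of vertices, $\mathcal I$ a finite set of internal edges, $\mathcal E$ a finite set of external edges; $\partial$ assigns to each $i\in\mathcal I$ an ordered pair $(\partial^-(i),\partial^+(i))$ of (possibly equal) vertices and to each $e\in\mathcal E$ a single vertex $\partial(e)$. Fix lengths $\underline a=\{a_i\}_{i\in\mathcal I}$, $a_i>0$; $I_i=[0,a_i]$ for $i\in\mathcal I$, $I_e=[0,\infty)$ for $e\in\mathcal E$. $\mathcal H=\bigoplus_{j}L^2(I_j)$; $\mathcal D$ is the set of $\psi\in\mathcal H$ with $\psi_j,\psi_j'$ absolutely continuous and $\psi_j''\in L^2$. $\mathcal K=\mathbb C^{|\mathcal E|}\oplus\mathbb C^{|\mathcal I|}\oplus\mathbb C^{|\mathcal I|}$, ${}^d\mathcal K=\mathcal K\oplus\mathcal K$. For $\psi\in\mathcal D$: $\underline\psi=(\{\psi_e(0)\}_{e},\{\psi_i(0)\}_{i},\{\psi_i(a_i)\}_{i})$, $\underline\psi'=(\{\psi_e'(0)\}_{e},\{\psi_i'(0)\}_{i},\{-\psi_i'(a_i)\}_{i})$.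 For linear $A,B:\mathcal K\to\mathcal K$ with $(A,B):{}^d\mathcal K\to\mathcal K$ of rank $|\mathcal E|+2|\mathcal I|$ and $AB^\dagger$ self-adjoint, $\mathcal M(A,B)=\{\chi_1\oplus\chi_2:A\chi_1+B\chi_2=0\}$ is a maximal isotropic subspace, and all maximal isotropic subspaces arise this way. $\Delta(\mathcal M,\underline a)$ is the self-adjoint operator $(\Delta\psi)_j=\psi_j''$ on $\{\psi\in\mathcal D: A\underline\psi+B\underline\psi'=0\}$. Let $P_{\ker B}$ be the orthogonal projection onto $\ker B$, $P^\perp_{\ker B}=\mathbb I-P_{\ker B}$, and $L=(B|_{\operatorname{Ran}B^\dagger})^{-1}AP^\perp_{\ker B}$; this is a self-adjoint operator on $\mathcal K$ depending only on $\mathcal M(A,B)$. *)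

theory Defs
  imports "HOL-Analysis.Analysis"
begin

definition cvec :: "nat \<Rightarrow> (nat \<Rightarrow> complex) set" where
  "cvec n = {x. \<forall>k\<ge>n. x k = 0}"

definition cmat :: "nat \<Rightarrow> (nat \<Rightarrow> nat \<Rightarrow> complex) set" where
  "cmat n = {M. \<forall>k l. (n \<le> k \<or> n \<le> l) \<longrightarrow> M k l = 0}"

definition mv :: "nat \<Rightarrow> (nat \<Rightarrow> nat \<Rightarrow> complex) \<Rightarrow> (nat \<Rightarrow> complex) \<Rightarrow> (nat \<Rightarrow> complex)" where
  "mv n M x = (\<lambda>k. if k < n then (\<Sum>l<n. M k l * x l) else 0)"

definition mm :: "nat \<Rightarrow> (nat \<Rightarrow> nat \<Rightarrow> complex) \<Rightarrow> (nat \<Rightarrow> nat \<Rightarrow> complex) \<Rightarrow> (nat \<Rightarrow> nat \<Rightarrow> complex)" where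
  "mm n M N = (\<lambda>k l. if k < n \<and> l < n then (\<Sum>j<n. M k j * N j l) else 0)"

definition adj :: "nat \<Rightarrow> (nat \<Rightarrow> nat \<Rightarrow> complex) \<Rightarrow> (nat \<Rightarrow> nat \<Rightarrow> complex)" where
  "adj n M = (\<lambda>k l. if k < n \<and> l < n then cnj (M l k) else 0)"

definition cinner :: "nat \<Rightarrow> (nat \<Rightarrow> complex) \<Rightarrow> (nat \<Rightarrow> complex) \<Rightarrow> complex" where
  "cinner n x y = (\<Sum>k<n. cnj (x k) * y k)"

definition vnorm :: "nat \<Rightarrow> (nat \<Rightarrow> complex) \<Rightarrow> real" where
  "vnorm n x = sqrt (\<Sum>k<n. (cmod (x k))\<^sup>2)"

definition opnorm :: "nat \<Rightarrow> (nat \<Rightarrow> nat \<Rightarrow> complex) \<Rightarrow> real" where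
  "opnorm n M = Sup {vnorm n (mv n M x) | x. x \<in> cvec n \<and> vnorm n x \<le> 1}"

definition ker :: "nat \<Rightarrow> (nat \<Rightarrow> nat \<Rightarrow> complex) \<Rightarrow> (nat \<Rightarrow> complex) set" where
  "ker n M = {x \<in> cvec n. mv n M x = (\<lambda>_. 0)}"

definition ran :: "nat \<Rightarrow> (nat \<Rightarrow> nat \<Rightarrow> complex) \<Rightarrow> (nat \<Rightarrow> complex) set" where
  "ran n M = mv n M ` cvec n"

definition orth_proj :: "nat \<Rightarrow> (nat \<Rightarrow> complex) set \<Rightarrow> (nat \<Rightarrow> complex) \<Rightarrow> (nat \<Rightarrow> complex)" where
  "orth_proj n W x = (THE p. p \<in> W \<and> (\<forall>w\<in>W. cinner n w (\<lambda>k. x k - p k) = 0))"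

text \<open>the operator L = (B restricted to Ran B^dagger)^{-1} A P^perp_{ker B}, as a function on C^n\<close>
definition Lop :: "nat \<Rightarrow> (nat \<Rightarrow> nat \<Rightarrow> complex) \<Rightarrow> (nat \<Rightarrow> nat \<Rightarrow> complex) \<Rightarrow> (nat \<Rightarrow> complex) \<Rightarrow> (nat \<Rightarrow> complex)" where
  "Lop n A B x = (THE y. y \<in> ran n (adj n B) \<and>
      mv n B y = mv n A (\<lambda>k. x k - orth_proj n (ker n B) x k))"

definition Lmat :: "nat \<Rightarrow> (nat \<Rightarrow> nat \<Rightarrow> complex) \<Rightarrow> (nat \<Rightarrow> nat \<Rightarrow> complex) \<Rightarrow> (nat \<Rightarrow> nat \<Rightarrow> complex)" where
  "Lmat n A B = (\<lambda>k l. if k < n \<and> l < n then Lop n A B (\<lambda>j. if j = l then 1 else 0) k else 0)"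

definition hermitian :: "nat \<Rightarrow> (nat \<Rightarrow> nat \<Rightarrow> complex) \<Rightarrow> bool" where
  "hermitian n M \<longleftrightarrow> M \<in> cmat n \<and> adj n M = M"

definition psd :: "nat \<Rightarrow> (nat \<Rightarrow> nat \<Rightarrow> complex) \<Rightarrow> bool" where
  "psd n M \<longleftrightarrow> hermitian n M \<and> (\<forall>x\<in>cvec n. 0 \<le> Re (cinner n x (mv n M x)))"

definition pos_part :: "nat \<Rightarrow> (nat \<Rightarrow> nat \<Rightarrow> complex) \<Rightarrow> (nat \<Rightarrow> nat \<Rightarrow> complex)" where
  "pos_part n M = (THE P. \<exists>N. psd n P \<and> psd n N \<and> M = (\<lambda>k l. P k l - N k l) \<and>
      mm n P N = (\<lambda>_ _. 0))"

definition abs_cont_on :: "real set \<Rightarrow> (real \<Rightarrow> complex) \<Rightarrow> bool" where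
  "abs_cont_on S f \<longleftrightarrow> (\<forall>\<epsilon>>0. \<exists>\<delta>>0. \<forall>(m::nat) (u::nat \<Rightarrow> real) v.
      (\<forall>k<m. u k \<in> S \<and> v k \<in> S \<and> u k \<le> v k) \<and>
      (\<forall>k<m. \<forall>l<m. k \<noteq> l \<longrightarrow> v k \<le> u l \<or> v l \<le> u k) \<and>
      (\<Sum>k<m. v k - u k) < \<delta>
      \<longrightarrow> (\<Sum>k<m. cmod (f (v k) - f (u k))) < \<epsilon>)"

text \<open>(locally) absolutely continuous: absolutely continuous on every bounded part;
  for a compact interval this is plain absolute continuity\<close>
definition loc_abs_cont_on :: "real set \<Rightarrow> (real \<Rightarrow> complex) \<Rightarrow> bool" where
  "loc_abs_cont_on S f \<longleftrightarrow> (\<forall>b. abs_cont_on (S \<inter> {..b}) f)"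

definition L2_on :: "real set \<Rightarrow> (real \<Rightarrow> complex) \<Rightarrow> bool" where
  "L2_on S f \<longleftrightarrow> f \<in> borel_measurable (lebesgue_on S) \<and>
      integrable (lebesgue_on S) (\<lambda>x. (cmod (f x))\<^sup>2)"

definition edge_H2 :: "real set \<Rightarrow> (real \<Rightarrow> complex) \<Rightarrow> (real \<Rightarrow> complex) \<Rightarrow> (real \<Rightarrow> complex) \<Rightarrow> bool" where
  "edge_H2 S f d g \<longleftrightarrow> L2_on S f \<and> loc_abs_cont_on S f \<and> loc_abs_cont_on S d \<and>
      (AE x in lebesgue_on S. (f has_vector_derivative d x) (at x)) \<and>
      (AE x in lebesgue_on S. (d has_vector_derivative g x) (at x)) \<and>
      L2_on S g"

text \<open>Edges are numbered: j < nE external edges with interval [0,\<infinity>);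
  j = nE + i (i < nI) internal edge i with interval [0, a i].\<close>
definition edge_interval :: "nat \<Rightarrow> (nat \<Rightarrow> real) \<Rightarrow> nat \<Rightarrow> real set" where
  "edge_interval nE a j = (if j < nE then {0..} else {0..a (j - nE)})"

text \<open>Boundary value vector in K = C^nE + C^nI + C^nI (dimension nE + 2 nI)\<close>
definition bval :: "nat \<Rightarrow> nat \<Rightarrow> (nat \<Rightarrow> real) \<Rightarrow> (nat \<Rightarrow> real \<Rightarrow> complex) \<Rightarrow> (nat \<Rightarrow> complex)" where
  "bval nE nI a \<psi> = (\<lambda>k. if k < nE + nI then \<psi> k 0
      else if k < nE + 2 * nI then \<psi> (k - nI) (a (k - nE - nI)) else 0)"

text \<open>Boundary derivative vector (outgoing sign convention: minus at the end points a_i)\<close>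
definition bder :: "nat \<Rightarrow> nat \<Rightarrow> (nat \<Rightarrow> real) \<Rightarrow> (nat \<Rightarrow> real \<Rightarrow> complex) \<Rightarrow> (nat \<Rightarrow> complex)" where
  "bder nE nI a d = (\<lambda>k. if k < nE + nI then d k 0
      else if k < nE + 2 * nI then - d (k - nI) (a (k - nE - nI)) else 0)"

definition s_sol :: "real \<Rightarrow> real \<Rightarrow> real" where
  "s_sol amin t = (THE s. 0 \<le> s \<and> s * tanh (amin * s / 2) = t)"

end

theory Submission
  imports "Jordan_Normal_Form.Schur_Decomposition" Defs
begin

text \<open>The boundary conditions force \<open>\<langle>\<psi>, \<psi>'\<rangle> = - \<langle>\<psi>, L \<psi>\<rangle> \<ge> - \<parallel>L\<^sub>+\<parallel> \<parallel>\<psi>\<parallel>\<^sup>2\<close> for the boundary values,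
  because every boundary vector has the form \<open>(B\<^sup>\<dagger>u, - A\<^sup>\<dagger>u)\<close>. On each edge, integrating the derivative of
  \<open>Re (cnj \<psi> * \<psi>') - q \<bar>\<psi>\<bar>\<^sup>2\<close> for a solution \<open>q\<close> of the Riccati equation \<open>q' + q\<^sup>2 = s\<^sup>2\<close>, namely
  \<open>q x = s tanh (s (x - a\<^sub>i / 2))\<close> on an internal and \<open>q = - s\<close> on an external edge, bounds
  \<open>\<langle>\<psi>, - \<psi>''\<rangle> + s\<^sup>2 \<parallel>\<psi>\<parallel>\<^sup>2\<close> from below by the boundary terms plus at least \<open>s tanh (a s / 2)\<close> times the
  squares of the boundary values. The choice \<open>s tanh (a s / 2) = \<parallel>L\<^sub>+\<parallel>\<close> balances the two estimates.\<close>

section \<open>Absolutely continuous functions\<close>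

text \<open>The functions \<open>q\<close> are logarithmic derivatives y'/y of positive solutions of
  y'' = \<open>s\<^sup>2\<close> y: the hyperbolic cosine centred at the midpoint of an internal
  edge, and the decaying exponential on an external one. Three obstacles shape the development. The
  derivatives of \<open>\<psi>\<close> and of \<open>\<psi>'\<close> are given only almost
  everywhere, so every integration rests on a fundamental theorem for absolutely continuous
  functions. On a half-line the boundary term at the cut-off point has to be controlled; square
  integrability makes it small from above at arbitrarily large points, which is enough. Finally,
  \<open>L\<close> and its positive part are given by definite descriptions, so existence and
  uniqueness must be established for both; this is where the spectral theorem for Hermitian matrices
  enters.\<close>

definition nonoverlapping :: "real set \<Rightarrow> 'i set \<Rightarrow> ('i \<Rightarrow> real) \<Rightarrow> ('i \<Rightarrow> real) \<Rightarrow> bool" where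
  "nonoverlapping S I u v \<longleftrightarrow> (\<forall>i\<in>I. u i \<in> S \<and> v i \<in> S \<and> u i \<le> v i) \<and>
      (\<forall>i\<in>I. \<forall>j\<in>I. i \<noteq> j \<longrightarrow> v i \<le> u j \<or> v j \<le> u i)"

lemma abs_cont_on_iff:
  "abs_cont_on S f \<longleftrightarrow> (\<forall>e>0. \<exists>\<delta>>0. \<forall>(m::nat) u v. nonoverlapping S {..<m} u v \<and>
      (\<Sum>k<m. v k - u k) < \<delta> \<longrightarrow> (\<Sum>k<m. cmod (f (v k) - f (u k))) < e)"
  by (simp add: abs_cont_on_def nonoverlapping_def Ball_def conj_assoc)

text \<open>Enumerating a finite set carries the same \<open>\<delta>\<close> over from numbered
  families to any index type, so that a set of tagged intervals can later index itself.\<close>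

lemma abs_cont_on_finite_family:
  assumes "abs_cont_on S f" "0 < e"
  shows "\<exists>\<delta>>0. \<forall>(I :: 'i set) u v. finite I \<and> nonoverlapping S I u v \<and> (\<Sum>i\<in>I. v i - u i) < \<delta>
     \<longrightarrow> (\<Sum>i\<in>I. cmod (f (v i) - f (u i))) < e"
proof -
  from assms obtain \<delta> where "0 < \<delta>" and \<delta>: "\<forall>(m::nat) u v. nonoverlapping S {..<m} u v \<and>
      (\<Sum>k<m. v k - u k) < \<delta> \<longrightarrow> (\<Sum>k<m. cmod (f (v k) - f (u k))) < e"
    unfolding abs_cont_on_iff by blast
  have "(\<Sum>i\<in>I. cmod (f (v i) - f (u i))) < e"
    if I: "finite I" "nonoverlapping S I u v" "(\<Sum>i\<in>I. v i - u i) < \<delta>" for I :: "'i set" and u v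
  proof -
    obtain h where h: "bij_betw h {..<card I} I"
      using ex_bij_betw_nat_finite[OF I(1)] by (metis atLeast0LessThan)
    have re: "(\<Sum>k<card I. F (h k)) = (\<Sum>i\<in>I. F i)" for F :: "'i \<Rightarrow> real"
      by (rule sum.reindex_bij_betw[OF h])
    have "nonoverlapping S {..<card I} (u \<circ> h) (v \<circ> h)"
      using I(2) bij_betwE[OF h] bij_betw_imp_inj_on[OF h]
      unfolding nonoverlapping_def inj_on_def comp_def by metis
    moreover have "(\<Sum>k<card I. (v \<circ> h) k - (u \<circ> h) k) < \<delta>"
      using I(3) re[of "\<lambda>i. v i - u i"] by simp
    ultimately have "(\<Sum>k<card I. cmod (f ((v \<circ> h) k) - f ((u \<circ> h) k))) < e"
      by (intro \<delta>[rule_format] conjI)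
    then show "(\<Sum>i\<in>I. cmod (f (v i) - f (u i))) < e"
      using re[of "\<lambda>i. cmod (f (v i) - f (u i))"] by simp
  qed
  with \<open>0 < \<delta>\<close> show ?thesis by blast
qed

section \<open>Closure properties of absolute continuity\<close>

lemma abs_cont_on_subset:
  assumes "abs_cont_on S f" "T \<subseteq> S" shows "abs_cont_on T f"
proof -
  have "nonoverlapping S I u v" if "nonoverlapping T I u v" for I :: "nat set" and u v
    using that assms(2) by (auto simp: nonoverlapping_def)
  then show ?thesis using assms(1) unfolding abs_cont_on_iff by meson
qed

lemma abs_cont_on_continuous_on:
  assumes "abs_cont_on S f" shows "continuous_on S f"
  unfolding continuous_on_iff
proof (intro ballI allI impI)
  fix x e :: real assume "x \<in> S" "0 < e"
  obtain \<delta> where "0 < \<delta>" and \<delta>: "\<forall>(I :: unit set) u v. finite I \<and> nonoverlapping S I u v \<and>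
      (\<Sum>i\<in>I. v i - u i) < \<delta> \<longrightarrow> (\<Sum>i\<in>I. cmod (f (v i) - f (u i))) < e"
    using abs_cont_on_finite_family[OF assms \<open>0 < e\<close>] by blast
  \<comment> \<open>A single interval between \<open>x\<close> and \<open>y\<close> is tested;
    \<open>min\<close> and \<open>max\<close> put its endpoints in order.\<close>
  have "dist (f y) (f x) < e" if "y \<in> S" "dist y x < \<delta>" for y
    using spec[OF spec[OF spec[OF \<delta>, of "{()}"], of "\<lambda>_. min x y"], of "\<lambda>_. max x y"] that \<open>x \<in> S\<close>
    by (auto simp: nonoverlapping_def dist_norm min_def max_def norm_minus_commute split: if_splits)
  then show "\<exists>d>0. \<forall>y\<in>S. dist y x < d \<longrightarrow> dist (f y) (f x) < e"
    using \<open>0 < \<delta>\<close> by blast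
qed

text \<open>One comparison of increments covers conjugates, differences, products and Lipschitz
  functions alike.\<close>

lemma abs_cont_on_lipschitz_pair:
  assumes f: "abs_cont_on S f" and g: "abs_cont_on S g" and "0 \<le> M"
    and le: "\<And>x y. \<lbrakk>x \<in> S; y \<in> S\<rbrakk> \<Longrightarrow> cmod (h y - h x) \<le> M * (cmod (f y - f x) + cmod (g y - g x))"
  shows "abs_cont_on S h"
  unfolding abs_cont_on_iff
proof (intro allI impI)
  fix e :: real assume "0 < e"
  \<comment> \<open>Dividing by \<open>M + 1\<close> instead of \<open>M\<close> covers
    \<open>M = 0\<close> and makes the final estimate strict.\<close>
  obtain e' where "0 < e'" and e': "(M + 1) * (e' + e') = e"
  proof (rule that[of "e / (M + 1) / 2"])
    show "(M + 1) * (e / (M + 1) / 2 + e / (M + 1) / 2) = e"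
      unfolding field_sum_of_halves using \<open>0 \<le> M\<close> by simp
  qed (use \<open>0 < e\<close> \<open>0 \<le> M\<close> in auto)
  obtain \<delta>f where "0 < \<delta>f" and \<delta>f: "\<forall>(m::nat) u v.
      nonoverlapping S {..<m} u v \<and> (\<Sum>k<m. v k - u k) < \<delta>f
      \<longrightarrow> (\<Sum>k<m. cmod (f (v k) - f (u k))) < e'"
    using f \<open>0 < e'\<close> unfolding abs_cont_on_iff by blast
  obtain \<delta>g where "0 < \<delta>g" and \<delta>g: "\<forall>(m::nat) u v.
      nonoverlapping S {..<m} u v \<and> (\<Sum>k<m. v k - u k) < \<delta>g
      \<longrightarrow> (\<Sum>k<m. cmod (g (v k) - g (u k))) < e'"
    using g \<open>0 < e'\<close> unfolding abs_cont_on_iff by blast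
  have "(\<Sum>k<m. cmod (h (v k) - h (u k))) < e"
    if *: "nonoverlapping S {..<m} u v \<and> (\<Sum>k<m. v k - u k) < min \<delta>f \<delta>g"
    for m :: nat and u v :: "nat \<Rightarrow> real"
  proof -
    have "(\<Sum>k<m. cmod (h (v k) - h (u k)))
        \<le> (\<Sum>k<m. M * (cmod (f (v k) - f (u k)) + cmod (g (v k) - g (u k))))"
      using * by (intro sum_mono le) (auto simp: nonoverlapping_def)
    also have "\<dots> = M * ((\<Sum>k<m. cmod (f (v k) - f (u k))) + (\<Sum>k<m. cmod (g (v k) - g (u k))))"
      by (simp add: sum_distrib_left[symmetric] sum.distrib)
    also have "\<dots> \<le> M * (e' + e')"
      using \<delta>f \<delta>g * \<open>0 \<le> M\<close> by (intro mult_left_mono add_mono) (auto intro!: less_imp_le)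
    also have "\<dots> < (M + 1) * (e' + e')"
      using \<open>0 < e'\<close> by simp
    also have "\<dots> = e"
      by (fact e')
    finally show ?thesis .
  qed
  then show "\<exists>\<delta>>0. \<forall>m (u::nat \<Rightarrow> real) v.
      nonoverlapping S {..<m} u v \<and> (\<Sum>k<m. v k - u k) < \<delta>
      \<longrightarrow> (\<Sum>k<m. cmod (h (v k) - h (u k))) < e"
    using \<open>0 < \<delta>f\<close> \<open>0 < \<delta>g\<close> by (intro exI[of _ "min \<delta>f \<delta>g"]) auto
qed

lemma abs_cont_on_cnj: "abs_cont_on S f \<Longrightarrow> abs_cont_on S (\<lambda>x. cnj (f x))"
  by (rule abs_cont_on_lipschitz_pair[of S f f 1])
    (auto simp flip: complex_cnj_diff)

lemma abs_cont_on_diff: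
  assumes "abs_cont_on S f" "abs_cont_on S g"
  shows "abs_cont_on S (\<lambda>x. f x - g x)"
proof (rule abs_cont_on_lipschitz_pair[OF assms, of 1])
  show "cmod (f y - g y - (f x - g x)) \<le> 1 * (cmod (f y - f x) + cmod (g y - g x))" for x y
    using norm_triangle_ineq4[of "f y - f x" "g y - g x"] by (simp add: algebra_simps)
qed simp

text \<open>Compactness bounds both factors, and these bounds turn the product rule for increments
  into a Lipschitz estimate.\<close>

lemma abs_cont_on_mult:
  assumes "compact S" and f: "abs_cont_on S f" and g: "abs_cont_on S g"
  shows "abs_cont_on S (\<lambda>x. f x * g x)"
proof -
  have "bounded (f ` S)" "bounded (g ` S)"
    using assms by (auto intro!: compact_imp_bounded compact_continuous_image abs_cont_on_continuous_on)
  then obtain Mf Mg where "0 < Mf" "0 < Mg"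
    and M: "\<And>x. x \<in> S \<Longrightarrow> cmod (f x) \<le> Mf" "\<And>x. x \<in> S \<Longrightarrow> cmod (g x) \<le> Mg"
    unfolding bounded_pos by auto
  show ?thesis
  proof (rule abs_cont_on_lipschitz_pair[OF f g])
    show "0 \<le> Mf + Mg" using \<open>0 < Mf\<close> \<open>0 < Mg\<close> by simp
    fix x y assume "x \<in> S" "y \<in> S"
    have "f y * g y - f x * g x = (f y - f x) * g y + f x * (g y - g x)"
      by (simp add: algebra_simps)
    then have "cmod (f y * g y - f x * g x) \<le> cmod (f y - f x) * cmod (g y) + cmod (f x) * cmod (g y - g x)"
      by (metis norm_mult norm_triangle_ineq)
    also have "\<dots> \<le> cmod (f y - f x) * (Mf + Mg) + (Mf + Mg) * cmod (g y - g x)"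
      using M(2)[OF \<open>y \<in> S\<close>] M(1)[OF \<open>x \<in> S\<close>] \<open>0 < Mf\<close> \<open>0 < Mg\<close>
      by (intro add_mono mult_left_mono mult_right_mono) auto
    finally show "cmod (f y * g y - f x * g x) \<le> (Mf + Mg) * (cmod (f y - f x) + cmod (g y - g x))"
      by (simp add: algebra_simps)
  qed
qed

text \<open>The comparison function is the embedding of the reals into the complex numbers, for
  which \<open>\<delta>\<close> can be taken equal to \<open>e\<close>.\<close>

lemma abs_cont_on_lipschitz:
  assumes "0 \<le> M" "\<And>x y. \<lbrakk>x \<in> S; y \<in> S\<rbrakk> \<Longrightarrow> cmod (h y - h x) \<le> M * \<bar>y - x\<bar>"
  shows "abs_cont_on S h"
proof -
  have "abs_cont_on S of_real"
    unfolding abs_cont_on_iff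
  proof (intro allI impI)
    fix e :: real assume "0 < e"
    have "(\<Sum>k<m. cmod (complex_of_real (v k) - of_real (u k))) = (\<Sum>k<m. v k - u k)"
      if "nonoverlapping S {..<m} u v" for m :: nat and u v
      using that by (intro sum.cong) (auto simp: nonoverlapping_def simp flip: of_real_diff)
    then show "\<exists>\<delta>>0. \<forall>(m::nat) u v. nonoverlapping S {..<m} u v \<and> (\<Sum>k<m. v k - u k) < \<delta>
      \<longrightarrow> (\<Sum>k<m. cmod (complex_of_real (v k) - of_real (u k))) < e"
      using \<open>0 < e\<close> by (intro exI[of _ e]) auto
  qed
  then show ?thesis
  proof (rule abs_cont_on_lipschitz_pair)
    show "abs_cont_on S (\<lambda>_. 0)" unfolding abs_cont_on_iff by (auto intro: exI[of _ 1])
  qed (use assms in \<open>auto simp flip: of_real_diff\<close>)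
qed

text \<open>The gauge treats two kinds of tags. Off the null set \<open>N\<close> it enforces the
  difference quotient estimate; on \<open>N\<close> it confines the intervals to an open set of
  small measure, where absolute continuity makes the increments of \<open>f\<close> small. The gauge
  integral delivers integrability of \<open>g\<close> together with the value.\<close>

theorem fundamental_theorem_of_calculus_abs_cont:
  fixes f :: "real \<Rightarrow> complex"
  assumes ab: "a \<le> b" and ac: "abs_cont_on {a..b} f"
    and der: "AE x in lebesgue_on {a..b}. (f has_vector_derivative g x) (at x)"
  shows "(g has_integral (f b - f a)) {a..b}"
proof (cases "a = b")
  case True
  then show ?thesis using has_integral_null_real[of a b g] by simp
next
  case False
  then have "a < b" using ab by simp
  obtain N where N: "negligible N" and
    derN: "\<And>x. x \<in> {a..b} - N \<Longrightarrow> (f has_vector_derivative g x) (at x)"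
  proof -
    have "AE x in lebesgue. x \<in> {a..b} \<longrightarrow> (f has_vector_derivative g x) (at x)"
      using der by (simp add: AE_restrict_space_iff)
    then obtain N where "negligible N" "{x. \<not> (x \<in> {a..b} \<longrightarrow> (f has_vector_derivative g x) (at x))} \<subseteq> N"
      by (auto simp: eventually_ae_filter_negligible)
    then show thesis using that by blast
  qed
  \<comment> \<open>Zero on \<open>N\<close>, so that a tag in \<open>N\<close> contributes nothing
    but an increment of \<open>f\<close>; the integral does not see this change.\<close>
  define g0 where "g0 x = (if x \<in> N then 0 else g x)" for x
  have "(g0 has_integral (f b - f a)) {a..b}"
    unfolding has_integral_factor_content_real
  proof (intro allI impI)
    fix e :: real assume "0 < e"
    \<comment> \<open>Tags in \<open>N\<close> and tags outside \<open>N\<close> may each use up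
      half of the permitted error.\<close>
    have e': "0 < e / 2 * (b - a)" using \<open>0 < e\<close> \<open>a < b\<close> by simp
      obtain \<delta> where "0 < \<delta>" and \<delta>: "\<forall>(I :: (real \<times> real set) set) u v. finite I \<and>
          nonoverlapping {a..b} I u v \<and> (\<Sum>i\<in>I. v i - u i) < \<delta>
          \<longrightarrow> (\<Sum>i\<in>I. cmod (f (v i) - f (u i))) < e / 2 * (b - a)"
        using abs_cont_on_finite_family[OF ac e'] by blast
      have N_null: "N \<in> null_sets lebesgue" using N by (simp add: negligible_iff_null_sets)
      then obtain U where U: "open U" "N \<subseteq> U" "U - N \<in> lmeasurable" "emeasure lebesgue (U - N) < ennreal \<delta>"
        using sets_lebesgue_outer_open[of N \<delta>] \<open>0 < \<delta>\<close> by (auto simp: null_sets_def)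
      have "emeasure lebesgue U = emeasure lebesgue (U - N)"
        using emeasure_Diff_null_set[OF N_null] U(1) by simp
      then have emU: "emeasure lebesgue U < ennreal \<delta>" using U(4) by simp
      have lmU: "U \<in> lmeasurable"
        using less_trans[OF emU ennreal_less_top] U(1) by (intro fmeasurableI) auto
      then have mU: "measure lebesgue U < \<delta>"
        using emU \<open>0 < \<delta>\<close> by (simp only: emeasure_eq_measure2 ennreal_less_iff measure_nonneg)
      have "\<exists>r>0. if x \<in> N then ball x r \<subseteq> U else x \<in> {a..b} \<longrightarrow>
          (\<forall>y. \<bar>y - x\<bar> < r \<longrightarrow> cmod (f y - f x - (y - x) *\<^sub>R g x) \<le> e / 2 * \<bar>y - x\<bar>)" for x
      proof (cases "x \<in> N")
        case True
        then show ?thesis using U(1,2) unfolding open_contains_ball by auto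
      next
        case False
        then have "x \<in> {a..b} \<Longrightarrow> \<exists>r>0. \<forall>y. \<bar>y - x\<bar> < r \<longrightarrow>
            cmod (f y - f x - (y - x) *\<^sub>R g x) \<le> e / 2 * \<bar>y - x\<bar>"
          using derN[of x] half_gt_zero[OF \<open>0 < e\<close>]
          unfolding has_vector_derivative_def has_derivative_at_alt real_norm_def by blast
        with False show ?thesis by (cases "x \<in> {a..b}") (auto intro: exI[of _ 1])
      qed
      then obtain r where r: "\<And>x. 0 < r x" "\<And>x. x \<in> N \<Longrightarrow> ball x (r x) \<subseteq> U"
        "\<And>x y. \<lbrakk>x \<notin> N; x \<in> {a..b}; \<bar>y - x\<bar> < r x\<rbrakk> \<Longrightarrow>
            cmod (f y - f x - (y - x) *\<^sub>R g x) \<le> e / 2 * \<bar>y - x\<bar>"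
        by metis
    show "\<exists>d. gauge d \<and> (\<forall>p. p tagged_division_of {a..b} \<and> d fine p \<longrightarrow>
      norm (sum (\<lambda>(x,k). measure lborel k *\<^sub>R g0 x) p - (f b - f a)) \<le> e * measure lborel {a..b})"
      proof (intro exI conjI allI impI)
        show "gauge (\<lambda>x. ball x (r x))"
          using r(1) gauge_ball_dependent by blast
        fix p assume "p tagged_division_of {a..b} \<and> (\<lambda>x. ball x (r x)) fine p"
        then have p: "p tagged_division_of {a..b}" and fine: "(\<lambda>x. ball x (r x)) fine p" by auto
        have fin: "finite p" using p by blast
        have pK: "\<exists>u v. K = {u..v} \<and> u \<le> v \<and> u \<in> {a..b} \<and> v \<in> {a..b} \<and> x \<in> {u..v} \<and> {u..v} \<subseteq> ball x (r x)"
          if "(x, K) \<in> p" for x K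
          using tagged_division_ofD(2-4)[OF p that] fineD[OF fine that] by fastforce
        define D where "D = (\<lambda>(x, K). measure lborel K *\<^sub>R g0 x - (f (Sup K) - f (Inf K)))"
        \<comment> \<open>Degenerate intervals are left out: they have no local error, but one lying
          inside another interval would violate \<open>nonoverlapping\<close>.\<close>
        define pN where "pN = {(x, K) \<in> p. x \<in> N \<and> Inf K < Sup K}"
        define pG where "pG = {(x, K) \<in> p. x \<notin> N}"
        have fins: "finite pN" "finite pG" and sub: "pN \<subseteq> p" "pG \<subseteq> p" "pG \<inter> pN = {}"
          using fin by (auto simp: pN_def pG_def intro: finite_subset[OF _ fin])
        have D0: "D i = 0" if "i \<in> p - (pG \<union> pN)" for i
        proof -
          obtain x K where i: "i = (x, K)" by fastforce
          with that pK[of x K] show ?thesis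
            by (auto simp: D_def pG_def pN_def)
        qed
        have "sum (\<lambda>(x,k). measure lborel k *\<^sub>R g0 x) p - (f b - f a) = sum D p"
          unfolding additive_tagged_division_1[OF ab p, of f, symmetric] D_def
          by (simp add: sum_subtractf case_prod_unfold)
        also have "\<dots> = sum D (pG \<union> pN)"
          using sub D0 fin by (intro sum.mono_neutral_right) auto
        also have "\<dots> = sum D pG + sum D pN"
          using fins sub by (intro sum.union_disjoint) auto
        finally have split: "sum (\<lambda>(x,k). measure lborel k *\<^sub>R g0 x) p - (f b - f a) = sum D pG + sum D pN" .
        have "cmod (sum D pG) \<le> (\<Sum>(x,K)\<in>pG. e / 2 * (Sup K - Inf K))"
        proof (rule sum_norm_le)
          fix i assume "i \<in> pG"
          then obtain x K where i: "i = (x, K)" and xK: "(x, K) \<in> p" "x \<notin> N" by (auto simp: pG_def)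
          obtain u v where K: "K = {u..v}" "u \<le> v" "x \<in> {u..v}" and uv: "u \<in> {a..b}" "v \<in> {a..b}"
            "{u..v} \<subseteq> ball x (r x)" using pK[OF xK(1)] by blast
          have x: "x \<in> {a..b}" using K uv by auto
          have "u \<in> ball x (r x)" "v \<in> ball x (r x)" using uv(3) K(2) by auto
          then have *: "cmod (f u - f x - (u - x) *\<^sub>R g x) \<le> e / 2 * \<bar>u - x\<bar>"
             "cmod (f v - f x - (v - x) *\<^sub>R g x) \<le> e / 2 * \<bar>v - x\<bar>"
            using r(3)[OF xK(2) x] by (auto simp: dist_real_def abs_minus_commute)
          have "D i = (f u - f x - (u - x) *\<^sub>R g x) - (f v - f x - (v - x) *\<^sub>R g x)"
            using xK(2) K by (simp add: i D_def g0_def algebra_simps)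
          then have "cmod (D i) \<le> e / 2 * \<bar>u - x\<bar> + e / 2 * \<bar>v - x\<bar>"
            using norm_triangle_ineq4 * by (smt (verit))
          \<comment> \<open>The tag lies between \<open>u\<close> and \<open>v\<close>, so its
            distances to the endpoints add up to the length.\<close>
          also have "\<dots> = e / 2 * (v - u)"
            using K by (simp add: field_simps)
          finally show "cmod (D i) \<le> (case i of (x, K) \<Rightarrow> e / 2 * (Sup K - Inf K))"
            using K by (simp add: i)
        qed
        also have "\<dots> \<le> (\<Sum>(x,K)\<in>p. e / 2 * (Sup K - Inf K))"
        proof (rule sum_mono2[OF fin sub(2)])
          fix i assume "i \<in> p - pG"
          then show "0 \<le> (case i of (x, K) \<Rightarrow> e / 2 * (Sup K - Inf K))"
            using pK \<open>0 < e\<close> by (cases i) fastforce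
        qed
        also have "\<dots> = e / 2 * (b - a)"
          using additive_tagged_division_1[OF ab p, of "\<lambda>x. x"]
          unfolding case_prod_unfold sum_distrib_left[symmetric] by simp
        finally have G: "cmod (sum D pG) \<le> e / 2 * (b - a)" .
        have disj: "Sup (snd i) \<le> Inf (snd j) \<or> Sup (snd j) \<le> Inf (snd i)"
          if "i \<in> pN" "j \<in> pN" "i \<noteq> j" for i j
        proof -
          obtain x K y L where ij: "i = (x, K)" "j = (y, L)" by fastforce
          have inp: "(x, K) \<in> p" "(y, L) \<in> p" "Inf K < Sup K" "Inf L < Sup L"
            using that by (auto simp: ij pN_def)
          obtain u v u' v' where K: "K = {u..v}" "u \<le> v" "L = {u'..v'}" "u' \<le> v'"
            using pK inp by meson
          have "interior K \<inter> interior L = {}"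
            using tagged_division_ofD(5)[OF p inp(1,2)] that(3) ij by auto
          then have "max u u' \<ge> min v v'"
            using K by (auto simp: interior_atLeastAtMost_real)
          then show ?thesis using K inp by (auto simp: ij max_def min_def split: if_splits)
        qed
        \<comment> \<open>By fineness the intervals tagged in \<open>N\<close> lie in
          \<open>U\<close>, and having disjoint interiors they have total length at most the measure
          of \<open>U\<close>.\<close>
        have meas: "(\<Sum>i\<in>pN. Sup (snd i) - Inf (snd i)) < \<delta>"
        proof -
          have tp: "pN tagged_partial_division_of {a..b}"
            using p sub(1) tagged_partial_division_subset tagged_division_of_def by blast
          have "(\<Sum>i\<in>pN. Sup (snd i) - Inf (snd i)) = (\<Sum>(x,K)\<in>pN. measure lborel K)"
          proof (rule sum.cong[OF refl])
            fix i assume "i \<in> pN"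
            then obtain x K where "i = (x, K)" "(x, K) \<in> p" by (auto simp: pN_def)
            then show "Sup (snd i) - Inf (snd i) = (case i of (x, K) \<Rightarrow> measure lborel K)"
              using pK by fastforce
          qed
          also have "\<dots> = sum (measure lborel) (snd ` pN)"
            by (rule sum.over_tagged_division_lemma[OF tagged_partial_division_of_Union_self[OF tp]])
               (simp add: content_eq_0_interior)
          also have "\<dots> = sum (measure lebesgue) (snd ` pN)"
          proof (rule sum.cong[OF refl])
            fix K assume "K \<in> snd ` pN"
            then obtain x where "(x, K) \<in> p" by (auto simp: pN_def)
            then show "measure lborel K = measure lebesgue K" using pK[of x K] by auto
          qed
          also have "\<dots> = measure lebesgue (\<Union>(snd ` pN))"
            using content_division[OF partial_division_of_tagged_division[OF tp]] by simp
          also have "\<dots> \<le> measure lebesgue U"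
          proof (rule measure_mono_fmeasurable)
            show "\<Union>(snd ` pN) \<subseteq> U"
              using pK r(2) by (fastforce simp: pN_def)
            show "\<Union>(snd ` pN) \<in> sets lebesgue"
              using fins(1) pK by (intro sets.finite_Union) (fastforce simp: pN_def)+
          qed (rule lmU)
          finally show ?thesis using mU by simp
        qed
        have "cmod (sum D pN) \<le> (\<Sum>i\<in>pN. cmod (f (Sup (snd i)) - f (Inf (snd i))))"
          by (rule sum_norm_le) (auto simp: pN_def D_def g0_def norm_minus_commute)
        also have "\<dots> < e / 2 * (b - a)"
        proof -
          have "Inf (snd i) \<in> {a..b} \<and> Sup (snd i) \<in> {a..b} \<and> Inf (snd i) \<le> Sup (snd i)" if "i \<in> pN" for i
          proof -
            obtain x K where "i = (x, K)" "(x, K) \<in> p" using \<open>i \<in> pN\<close> by (auto simp: pN_def)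
            then show ?thesis using pK by fastforce
          qed
          then have "nonoverlapping {a..b} pN (\<lambda>i. Inf (snd i)) (\<lambda>i. Sup (snd i))"
            using disj unfolding nonoverlapping_def by blast
          then show ?thesis using \<delta> fins(1) meas by blast
        qed
        finally have "cmod (sum D pG + sum D pN) \<le> e / 2 * (b - a) + e / 2 * (b - a)"
          using G norm_triangle_ineq[of "sum D pG" "sum D pN"] by linarith
        then show "norm (sum (\<lambda>(x,k). measure lborel k *\<^sub>R g0 x) p - (f b - f a)) \<le> e * measure lborel {a..b}"
          unfolding split using ab by (simp add: algebra_simps)
      qed
  qed
  then show ?thesis
    by (rule has_integral_spike[OF N, rotated]) (simp add: g0_def)
qed

section \<open>Estimates on single edges\<close>

lemma loc_abs_cont_on_interval:
  assumes "loc_abs_cont_on S f" "{u..v} \<subseteq> S" shows "abs_cont_on {u..v} f"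
proof -
  have "abs_cont_on (S \<inter> {..v}) f" using assms(1) by (simp add: loc_abs_cont_on_def)
  then show ?thesis by (rule abs_cont_on_subset) (use assms(2) in auto)
qed

lemma AE_lebesgue_on_subset:
  assumes "AE x in lebesgue_on S. P x" "T \<subseteq> S" "S \<in> sets lebesgue" "T \<in> sets lebesgue"
  shows "AE x in lebesgue_on T. P x"
  using assms by (auto simp: AE_restrict_space_iff elim!: eventually_mono)

lemma lebesgue_on_absolutely_integrable:
  fixes f :: "real \<Rightarrow> 'a::euclidean_space"
  assumes "integrable (lebesgue_on S) f" "S \<in> sets lebesgue"
  shows "f absolutely_integrable_on S"
  using assms by (simp add: set_integrable_def integrable_restrict_space)

lemma L2_on_integrable_mult:
  assumes f: "L2_on S f" and g: "L2_on S g"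
  shows "integrable (lebesgue_on S) (\<lambda>x. cnj (f x) * g x)"
proof (rule Bochner_Integration.integrable_bound)
  show "integrable (lebesgue_on S) (\<lambda>x. (cmod (f x))\<^sup>2 + (cmod (g x))\<^sup>2)"
    using f g by (auto simp: L2_on_def)
  have [measurable]: "f \<in> borel_measurable (lebesgue_on S)" "g \<in> borel_measurable (lebesgue_on S)"
    using f g by (auto simp: L2_on_def)
  have "(\<lambda>x. cnj (f x)) \<in> borel_measurable (lebesgue_on S)"
    by (rule borel_measurable_continuous_on[OF continuous_on_cnj[OF continuous_on_id]]) measurable
  then show "(\<lambda>x. cnj (f x) * g x) \<in> borel_measurable (lebesgue_on S)" by measurable
  have "cmod (f x) * cmod (g x) \<le> (cmod (f x))\<^sup>2 + (cmod (g x))\<^sup>2" for x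
    using sum_squares_bound[of "cmod (f x)" "cmod (g x)"] mult_nonneg_nonneg[of "cmod (f x)" "cmod (g x)"]
    unfolding mult.assoc by (simp del: mult_nonneg_nonneg)
  then show "AE x in lebesgue_on S. norm (cnj (f x) * g x) \<le> norm ((cmod (f x))\<^sup>2 + (cmod (g x))\<^sup>2)"
    by (auto simp: norm_mult)
qed

lemma Re_cnj_mult_self: "Re (cnj z * z) = (cmod z)\<^sup>2"
  unfolding cmod_power2 by (simp add: power2_eq_square)

lemma abs_cont_on_of_real_bounded_deriv:
  fixes q :: "real \<Rightarrow> real"
  assumes "\<And>x. x \<in> {u..v} \<Longrightarrow> (q has_real_derivative q' x) (at x)" "\<And>x. x \<in> {u..v} \<Longrightarrow> \<bar>q' x\<bar> \<le> M"
  shows "abs_cont_on {u..v} (\<lambda>x. complex_of_real (q x))"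
proof (rule abs_cont_on_lipschitz)
  show "0 \<le> max M 0" by simp
  fix x y assume "x \<in> {u..v}" "y \<in> {u..v}"
  then have "norm (q y - q x) \<le> M * norm (y - x)"
    using assms by (intro field_differentiable_bound[of "{u..v}" q q']) (auto intro: has_field_derivative_at_within)
  also have "\<dots> \<le> max M 0 * norm (y - x)" by (intro mult_right_mono) auto
  finally show "cmod (complex_of_real (q y) - complex_of_real (q x)) \<le> max M 0 * \<bar>y - x\<bar>"
    by (simp flip: of_real_diff)
qed

text \<open>With \<open>q\<close> a solution of the Riccati equation \<open>q' + q\<^sup>2 = s\<^sup>2\<close>, the derivative of
  \<open>Re (cnj f * d) - q \<bar>f\<bar>\<^sup>2\<close> is \<open>Re (cnj f * g) - s\<^sup>2 \<bar>f\<bar>\<^sup>2 + \<bar>d - q f\<bar>\<^sup>2\<close>.\<close>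
lemma riccati_estimate:
  fixes f d g :: "real \<Rightarrow> complex" and q :: "real \<Rightarrow> real"
  assumes uv: "u \<le> v" and f: "abs_cont_on {u..v} f" and d: "abs_cont_on {u..v} d"
    and f': "AE x in lebesgue_on {u..v}. (f has_vector_derivative d x) (at x)"
    and d': "AE x in lebesgue_on {u..v}. (d has_vector_derivative g x) (at x)"
    and q: "\<And>x. x \<in> {u..v} \<Longrightarrow> (q has_real_derivative s\<^sup>2 - (q x)\<^sup>2) (at x)"
    and qs: "\<And>x. x \<in> {u..v} \<Longrightarrow> \<bar>q x\<bar> \<le> s"
    and int: "(\<lambda>x. Re (cnj (f x) * g x) - s\<^sup>2 * (cmod (f x))\<^sup>2) integrable_on {u..v}"
  shows "integral {u..v} (\<lambda>x. Re (cnj (f x) * g x) - s\<^sup>2 * (cmod (f x))\<^sup>2)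
    \<le> (Re (cnj (f v) * d v) - q v * (cmod (f v))\<^sup>2) - (Re (cnj (f u) * d u) - q u * (cmod (f u))\<^sup>2)"
proof -
  \<comment> \<open>Kept complex to match the fundamental theorem; only its real part enters the
    estimate.\<close>
  define W where "W x = cnj (f x) * d x - of_real (q x) * (cnj (f x) * f x)" for x
  define W' where "W' x = (cnj (f x) * g x + cnj (d x) * d x) - (of_real (q x) * (cnj (f x) * d x + cnj (d x) * f x)
     + of_real (s\<^sup>2 - (q x)\<^sup>2) * (cnj (f x) * f x))" for x
  have ReW: "Re (W x) = Re (cnj (f x) * d x) - q x * (cmod (f x))\<^sup>2" for x
    unfolding W_def minus_complex.sel using Re_cnj_mult_self[of "f x"] by simp
  \<comment> \<open>By the Riccati equation the bound on \<open>q\<close> also bounds its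
    derivative, which makes \<open>q\<close> Lipschitz and thus an admissible factor in
    \<open>W\<close>.\<close>
  have "\<bar>s\<^sup>2 - (q x)\<^sup>2\<bar> \<le> s\<^sup>2" if "x \<in> {u..v}" for x
    using power_mono[OF qs[OF that], of 2] by simp
  then have "abs_cont_on {u..v} (\<lambda>x. complex_of_real (q x))"
    using q by (intro abs_cont_on_of_real_bounded_deriv)
  then have "abs_cont_on {u..v} W"
    unfolding W_def using f d by (intro abs_cont_on_diff abs_cont_on_mult abs_cont_on_cnj) auto
  moreover have "AE x in lebesgue_on {u..v}. (W has_vector_derivative W' x) (at x)"
    using f' d' AE_space
  proof eventually_elim
    case (elim x)
    then have "((\<lambda>x. complex_of_real (q x)) has_vector_derivative of_real (s\<^sup>2 - (q x)\<^sup>2)) (at x)"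
      using q[of x] by (intro has_vector_derivative_of_real) auto
    then show ?case
      unfolding W_def W'_def using elim
      by (intro has_vector_derivative_diff has_vector_derivative_mult has_vector_derivative_cnj)
  qed
  ultimately have "(W' has_integral W v - W u) {u..v}"
    by (rule fundamental_theorem_of_calculus_abs_cont[OF uv])
  from has_integral_linear[OF this bounded_linear_Re]
  have IW: "((\<lambda>x. Re (W' x)) has_integral Re (W v) - Re (W u)) {u..v}" by (simp add: comp_def)
  have le: "Re (cnj (f x) * g x) - s\<^sup>2 * (cmod (f x))\<^sup>2 \<le> Re (W' x)" for x
  proof -
    have "Re (W' x) = Re (cnj (f x) * g x) - s\<^sup>2 * (cmod (f x))\<^sup>2 + (cmod (d x - of_real (q x) * f x))\<^sup>2"
      unfolding W'_def cmod_power2 by (simp add: power2_eq_square algebra_simps)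
    then show ?thesis by simp
  qed
  have "integral {u..v} (\<lambda>x. Re (cnj (f x) * g x) - s\<^sup>2 * (cmod (f x))\<^sup>2) \<le> Re (W v) - Re (W u)"
    by (rule has_integral_le[OF integrable_integral[OF int] IW le])
  then show ?thesis by (simp only: ReW)
qed

lemma edge_H2_interval:
  assumes "edge_H2 S f d g" "{u..v} \<subseteq> S" "S \<in> sets lebesgue"
  shows "abs_cont_on {u..v} f" "abs_cont_on {u..v} d"
    "AE x in lebesgue_on {u..v}. (f has_vector_derivative d x) (at x)"
    "AE x in lebesgue_on {u..v}. (d has_vector_derivative g x) (at x)"
  using assms loc_abs_cont_on_interval AE_lebesgue_on_subset[where S = S and T = "{u..v}"]
  unfolding edge_H2_def by auto

lemma edge_H2_integrable:
  assumes "edge_H2 S f d g"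
  shows "integrable (lebesgue_on S) (\<lambda>x. cnj (f x) * g x)" "integrable (lebesgue_on S) (\<lambda>x. (cmod (f x))\<^sup>2)"
    "integrable (lebesgue_on S) (\<lambda>x. Re (cnj (f x) * g x) - s\<^sup>2 * (cmod (f x))\<^sup>2)"
proof -
  show 1: "integrable (lebesgue_on S) (\<lambda>x. cnj (f x) * g x)" "integrable (lebesgue_on S) (\<lambda>x. (cmod (f x))\<^sup>2)"
    using assms L2_on_integrable_mult by (auto simp: edge_H2_def L2_on_def)
  show "integrable (lebesgue_on S) (\<lambda>x. Re (cnj (f x) * g x) - s\<^sup>2 * (cmod (f x))\<^sup>2)"
    using 1 by (intro Bochner_Integration.integrable_diff integrable_Re integrable_mult_right)
qed

text \<open>Passes from the Lebesgue integrals of the quadratic form to the gauge integral that the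
  Riccati estimate bounds.\<close>

lemma edge_form_eq:
  assumes "edge_H2 S f d g" "S \<in> sets lebesgue"
  shows "Re (integral\<^sup>L (lebesgue_on S) (\<lambda>x. cnj (f x) * (- g x)))
      + s\<^sup>2 * integral\<^sup>L (lebesgue_on S) (\<lambda>x. (cmod (f x))\<^sup>2)
    = - integral S (\<lambda>x. Re (cnj (f x) * g x) - s\<^sup>2 * (cmod (f x))\<^sup>2)"
proof -
  note int = edge_H2_integrable[OF assms(1)]
  have "integral S (\<lambda>x. Re (cnj (f x) * g x) - s\<^sup>2 * (cmod (f x))\<^sup>2)
      = integral\<^sup>L (lebesgue_on S) (\<lambda>x. Re (cnj (f x) * g x) - s\<^sup>2 * (cmod (f x))\<^sup>2)"
    using lebesgue_integral_eq_integral[OF int(3) assms(2)] by simp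
  also have "\<dots> = Re (integral\<^sup>L (lebesgue_on S) (\<lambda>x. cnj (f x) * g x))
      - s\<^sup>2 * integral\<^sup>L (lebesgue_on S) (\<lambda>x. (cmod (f x))\<^sup>2)"
    using int(1,2) by (simp only: Bochner_Integration.integral_diff integrable_Re integrable_mult_right
        integral_Re Bochner_Integration.integral_mult_right_zero)
  finally show ?thesis by simp
qed

text \<open>Centring \<open>q\<close> at the midpoint makes it odd about that point, so both ends of
  the edge receive the same coefficient.\<close>

lemma internal_edge_estimate:
  assumes H: "edge_H2 {0..b} f d g" and "0 \<le> b" "0 \<le> s"
  shows "Re (cnj (f 0) * d 0) - Re (cnj (f b) * d b) + s * tanh (b * s / 2) * ((cmod (f 0))\<^sup>2 + (cmod (f b))\<^sup>2)
    \<le> Re (integral\<^sup>L (lebesgue_on {0..b}) (\<lambda>x. cnj (f x) * (- g x)))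
      + s\<^sup>2 * integral\<^sup>L (lebesgue_on {0..b}) (\<lambda>x. (cmod (f x))\<^sup>2)"
proof -
  define q where "q x = s * tanh (s * (x - b / 2))" for x
  have "integral {0..b} (\<lambda>x. Re (cnj (f x) * g x) - s\<^sup>2 * (cmod (f x))\<^sup>2)
    \<le> (Re (cnj (f b) * d b) - q b * (cmod (f b))\<^sup>2) - (Re (cnj (f 0) * d 0) - q 0 * (cmod (f 0))\<^sup>2)"
  proof (rule riccati_estimate[OF \<open>0 \<le> b\<close>])
    show "(q has_real_derivative s\<^sup>2 - (q x)\<^sup>2) (at x)" for x
      unfolding q_def by (auto intro!: derivative_eq_intros simp: power2_eq_square algebra_simps)
    show "\<bar>q x\<bar> \<le> s" for x
      using \<open>0 \<le> s\<close> tanh_real_lt_1[of "s * (x - b / 2)"] tanh_real_gt_neg1[of "s * (x - b / 2)"]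
      unfolding q_def abs_mult by (intro order_trans[OF mult_left_le[of "\<bar>tanh (s * (x - b / 2))\<bar>" "\<bar>s\<bar>"]]) auto
    show "(\<lambda>x. Re (cnj (f x) * g x) - s\<^sup>2 * (cmod (f x))\<^sup>2) integrable_on {0..b}"
      by (rule integrable_on_lebesgue_on[OF edge_H2_integrable(3)[OF H]]) simp
  qed (use edge_H2_interval[OF H, of 0 b] in auto)
  moreover have "q b = s * tanh (b * s / 2)" "q 0 = - (s * tanh (b * s / 2))"
  proof -
    have "s * (b - b / 2) = b * s / 2" "s * (0 - b / 2) = - (b * s / 2)" by (simp_all add: field_simps)
    then show "q b = s * tanh (b * s / 2)" "q 0 = - (s * tanh (b * s / 2))" by (simp_all only: q_def tanh_minus mult_minus_right)
  qed
  ultimately show ?thesis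
    using edge_form_eq[OF H, of s] by (simp add: algebra_simps)
qed

text \<open>Twice the real part of \<open>cnj f * d\<close> is the derivative of the squared modulus
  \<open>F\<close> of \<open>f\<close>. If the expression stayed above \<open>e\<close> beyond
  \<open>N\<close>, this derivative would exceed \<open>2 * e - 2 * s * F x\<close>; as
  \<open>F\<close> has finite integral, \<open>F\<close> would then grow at least linearly,
  contradicting that same integrability.\<close>

lemma edge_H2_boundary_small:
  assumes H: "edge_H2 {0..} f d g" and s: "0 \<le> s" and e: "0 < e" and N: "0 \<le> N"
  shows "\<exists>R\<ge>N. Re (cnj (f R) * d R) + s * (cmod (f R))\<^sup>2 \<le> e"
proof (rule ccontr)
  assume "\<not> ?thesis"
  then have big: "e < Re (cnj (f R) * d R) + s * (cmod (f R))\<^sup>2" if "N \<le> R" for R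
    using that by force
  define F where "F x = (cmod (f x))\<^sup>2" for x
  define K where "K = integral {0..} F"
  have F0: "0 \<le> F x" for x by (simp add: F_def)
  have intF: "F integrable_on {0..}"
    unfolding F_def by (rule integrable_on_lebesgue_on[OF edge_H2_integrable(2)[OF H]]) simp
  have intF_sub: "F integrable_on {u..v}" "integral {u..v} F \<le> K" if "0 \<le> u" for u v
  proof -
    show "F integrable_on {u..v}"
      using integrable_on_subinterval[OF intF, of u v] that by auto
    then show "integral {u..v} F \<le> K"
      unfolding K_def using that intF F0 by (intro integral_subset_le) auto
  qed
  have growth: "2 * e * (T - N) - 2 * s * K \<le> F T" if T: "N \<le> T" for T
  proof -
    have sub: "{N..T} \<subseteq> {0..}" using N by auto
    note HN = edge_H2_interval[OF H sub]
    define G' where "G' x = cnj (f x) * d x + cnj (d x) * f x" for x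
    have "(G' has_integral cnj (f T) * f T - cnj (f N) * f N) {N..T}"
    proof (rule fundamental_theorem_of_calculus_abs_cont[OF T])
      show "abs_cont_on {N..T} (\<lambda>x. cnj (f x) * f x)"
        using HN by (intro abs_cont_on_mult abs_cont_on_cnj) auto
      show "AE x in lebesgue_on {N..T}. ((\<lambda>x. cnj (f x) * f x) has_vector_derivative G' x) (at x)"
        using HN(3)[OF _] unfolding G'_def
        by (auto elim!: eventually_mono intro!: has_vector_derivative_mult has_vector_derivative_cnj)
    qed
    from has_integral_linear[OF this bounded_linear_Re]
    have I1: "((\<lambda>x. Re (G' x)) has_integral F T - F N) {N..T}"
      by (simp only: comp_def F_def minus_complex.sel Re_cnj_mult_self)
    have I2: "((\<lambda>x. 2 * e - 2 * s * F x) has_integral 2 * e * (T - N) - 2 * s * integral {N..T} F) {N..T}"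
      using has_integral_diff[OF has_integral_const_real[of "2 * e" N T]
          has_integral_mult_right[OF integrable_integral[OF intF_sub(1)[OF N]], of "2 * s"]] T
      by (simp add: mult.commute)
    have le: "2 * e - 2 * s * F x \<le> Re (G' x)" if "x \<in> {N..T}" for x
      using big[of x] that by (simp add: G'_def F_def algebra_simps)
    have "2 * e * (T - N) - 2 * s * integral {N..T} F \<le> F T - F N"
      by (rule has_integral_le[OF I2 I1 le])
    moreover have "2 * s * integral {N..T} F \<le> 2 * s * K"
      using intF_sub(2)[OF N] s by (intro mult_left_mono) auto
    ultimately show ?thesis using F0[of N] by linarith
  qed
  \<comment> \<open>The linear lower bound of \<open>growth\<close> equals 1 at this point, so
    \<open>F\<close> is at least 1 from there on.\<close>
  define T where "T = N + (1 + 2 * s * K) / (2 * e)"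
  have K0: "0 \<le> K" unfolding K_def using intF F0 by (intro integral_nonneg) auto
  then have T: "N \<le> T" "0 \<le> T" using s e N by (auto simp: T_def)
  have one: "1 \<le> F x" if "T \<le> x" for x
  proof -
    have "1 = 2 * e * (T - N) - 2 * s * K" using e by (simp add: T_def)
    also have "\<dots> \<le> 2 * e * (x - N) - 2 * s * K" using e that by simp
    also have "\<dots> \<le> F x" using that T by (intro growth) auto
    finally show ?thesis .
  qed
  \<comment> \<open>On an interval of length \<open>K + 1\<close> beyond \<open>T\<close> the
    integral of \<open>F\<close> would exceed its total \<open>K\<close>.\<close>
  have I1: "((\<lambda>_. 1::real) has_integral K + 1) {T..T + (K + 1)}"
    using has_integral_const_real[of "1::real" T "T + (K + 1)"] K0 by simp
  have "K + 1 \<le> integral {T..T + (K + 1)} F"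
    by (rule has_integral_le[OF I1 integrable_integral[OF intF_sub(1)[OF T(2)]]]) (simp add: one)
  then show False using intF_sub(2)[OF T(2), of "T + (K + 1)"] by simp
qed

text \<open>The constant \<open>- s\<close> solves the Riccati equation on the half-line. The
  estimate is made on \<open>{0..R}\<close> and \<open>R\<close> then runs through points at which
  the boundary term is nearly nonpositive.\<close>

lemma external_edge_estimate:
  assumes H: "edge_H2 {0..} f d g" and s: "0 \<le> s"
  shows "Re (cnj (f 0) * d 0) + s * (cmod (f 0))\<^sup>2
    \<le> Re (integral\<^sup>L (lebesgue_on {0..}) (\<lambda>x. cnj (f x) * (- g x)))
      + s\<^sup>2 * integral\<^sup>L (lebesgue_on {0..}) (\<lambda>x. (cmod (f x))\<^sup>2)"
proof -
  define h where "h x = Re (cnj (f x) * g x) - s\<^sup>2 * (cmod (f x))\<^sup>2" for x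
  have abs_int: "h absolutely_integrable_on {0..}"
    unfolding h_def by (rule lebesgue_on_absolutely_integrable[OF edge_H2_integrable(3)[OF H]]) simp
  have abs_int_sub: "h absolutely_integrable_on {0..R}" for R
    by (rule set_integrable_subset[OF abs_int]) auto
  have "((\<lambda>R. set_lebesgue_integral lebesgue {0..R} h) \<longlongrightarrow> set_lebesgue_integral lebesgue {0..} h) at_top"
    by (rule tendsto_set_lebesgue_integral_at_top[OF _ abs_int]) simp
  then have lim: "((\<lambda>R. integral {0..R} h) \<longlongrightarrow> integral {0..} h) at_top"
    using abs_int abs_int_sub by (simp add: set_lebesgue_integral_eq_integral(2))
  have est: "integral {0..R} h \<le> (Re (cnj (f R) * d R) + s * (cmod (f R))\<^sup>2) - (Re (cnj (f 0) * d 0) + s * (cmod (f 0))\<^sup>2)"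
    if "0 \<le> R" for R
  proof -
    have "integral {0..R} h \<le> (Re (cnj (f R) * d R) - (- s) * (cmod (f R))\<^sup>2) - (Re (cnj (f 0) * d 0) - (- s) * (cmod (f 0))\<^sup>2)"
      unfolding h_def
    proof (rule riccati_estimate[OF that])
      show "(\<lambda>x. Re (cnj (f x) * g x) - s\<^sup>2 * (cmod (f x))\<^sup>2) integrable_on {0..R}"
        using abs_int_sub[of R] unfolding h_def by (rule set_lebesgue_integral_eq_integral(1))
    qed (use edge_H2_interval[OF H, of 0 R] s in auto)
    then show ?thesis by simp
  qed
  \<comment> \<open>The truncation error and the boundary term at \<open>R\<close> each take half of
    \<open>e\<close>. The truncation is controlled for all large \<open>R\<close>, the boundary term
    only at selected ones, so \<open>R\<close> is selected last.\<close>
  have "integral {0..} h \<le> - (Re (cnj (f 0) * d 0) + s * (cmod (f 0))\<^sup>2)"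
  proof (rule field_le_epsilon)
    fix e :: real assume "0 < e"
    then have "\<forall>\<^sub>F R in at_top. dist (integral {0..R} h) (integral {0..} h) < e / 2"
      by (intro tendstoD[OF lim]) simp
    then obtain N where N: "\<And>R. N \<le> R \<Longrightarrow> dist (integral {0..R} h) (integral {0..} h) < e / 2"
      by (auto simp: eventually_at_top_linorder)
    obtain R where R: "max N 0 \<le> R" "Re (cnj (f R) * d R) + s * (cmod (f R))\<^sup>2 \<le> e / 2"
      using edge_H2_boundary_small[OF H s, of "e / 2" "max N 0"] \<open>0 < e\<close> by auto
    then have NR: "N \<le> R" "0 \<le> R" by auto
    have "integral {0..} h < integral {0..R} h + e / 2"
      using N[OF NR(1)] unfolding dist_real_def by linarith
    then show "integral {0..} h \<le> - (Re (cnj (f 0) * d 0) + s * (cmod (f 0))\<^sup>2) + e"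
      using est[OF NR(2)] R(2) by linarith
  qed
  moreover have "{0::real..} \<in> sets lebesgue" by simp
  ultimately show ?thesis
    using edge_form_eq[OF H, of s] unfolding h_def by simp
qed

section \<open>The scalar equation for s\<close>

lemma mult_tanh_strict_mono:
  fixes a s s' :: real
  assumes "0 < a" "0 \<le> s" "s < s'" shows "s * tanh (a * s / 2) < s' * tanh (a * s' / 2)"
proof -
  have "0 \<le> tanh (a * s / 2)" "tanh (a * s / 2) < tanh (a * s' / 2)" using assms by simp_all
  then show ?thesis using assms by (intro mult_strict_mono') auto
qed

text \<open>The definite description denotes: the left side is continuous, vanishes at 0, reaches
  \<open>t\<close>, and is strictly increasing.\<close>

lemma s_sol_properties:
  assumes "0 < a" "0 \<le> t" shows "0 \<le> s_sol a t" "s_sol a t * tanh (a * s_sol a t / 2) = t"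
proof -
  \<comment> \<open>Upper end for the intermediate value theorem: \<open>1 \<le> X\<close> keeps the
    tanh factor above \<open>tanh (a / 2)\<close>, and the other term then lifts the product to at
    least \<open>t\<close>.\<close>
  define X where "X = max 1 (t / tanh (a / 2))"
  have pos: "0 < tanh (a / 2)" using assms by simp
  have "t = t / tanh (a / 2) * tanh (a / 2)" using pos by simp
  also have "\<dots> \<le> X * tanh (a / 2)" using pos by (intro mult_right_mono) (auto simp: X_def)
  also have "\<dots> \<le> X * tanh (a * X / 2)"
    using assms by (intro mult_left_mono) (auto simp: X_def)
  finally have "t \<le> X * tanh (a * X / 2)" .
  moreover have "0 \<le> X" by (simp add: X_def)
  moreover have "continuous_on {0..X} (\<lambda>s. s * tanh (a * s / 2))"
    by (intro continuous_intros) (auto simp: cosh_real_nonzero)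
  ultimately obtain s where s: "0 \<le> s" "s * tanh (a * s / 2) = t"
    using IVT'[of "\<lambda>s. s * tanh (a * s / 2)" 0 t X] assms(2) by auto
  have "\<exists>!s. 0 \<le> s \<and> s * tanh (a * s / 2) = t"
  proof (rule ex1I)
    show "0 \<le> s \<and> s * tanh (a * s / 2) = t" using s by simp
    fix s' assume "0 \<le> s' \<and> s' * tanh (a * s' / 2) = t"
    then show "s' = s"
      using mult_tanh_strict_mono[OF assms(1), of s s'] mult_tanh_strict_mono[OF assms(1), of s' s] s
      by (cases s s' rule: linorder_cases) auto
  qed
  from theI'[OF this] show "0 \<le> s_sol a t" "s_sol a t * tanh (a * s_sol a t / 2) = t"
    by (simp_all add: s_sol_def)
qed

section \<open>Hermitian matrices\<close>

lemma cvec_add: "x \<in> cvec n \<Longrightarrow> y \<in> cvec n \<Longrightarrow> (\<lambda>k. x k + y k) \<in> cvec n"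
  and cvec_diff: "x \<in> cvec n \<Longrightarrow> y \<in> cvec n \<Longrightarrow> (\<lambda>k. x k - y k) \<in> cvec n"
  and cvec_scale: "x \<in> cvec n \<Longrightarrow> (\<lambda>k. c * x k) \<in> cvec n"
  and cvec_zero: "(\<lambda>_. 0) \<in> cvec n"
  and cvec_mv: "mv n M x \<in> cvec n"
  by (auto simp: cvec_def mv_def)

lemmas cvec_intros = cvec_add cvec_diff cvec_scale cvec_zero cvec_mv

lemma mv_add: "mv n M (\<lambda>k. x k + y k) = (\<lambda>k. mv n M x k + mv n M y k)"
  and mv_diff: "mv n M (\<lambda>k. x k - y k) = (\<lambda>k. mv n M x k - mv n M y k)"
  and mv_scale: "mv n M (\<lambda>k. c * x k) = (\<lambda>k. c * mv n M x k)"
  and mv_zero: "mv n M (\<lambda>_. 0) = (\<lambda>_. 0)"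
  by (auto simp: mv_def algebra_simps sum.distrib sum_subtractf sum_distrib_left intro!: ext)

lemma mv_mm: "mv n (mm n M N) x = mv n M (mv n N x)"
proof
  fix k
  have "(\<Sum>l<n. (\<Sum>j<n. M k j * N j l) * x l) = (\<Sum>j<n. M k j * (\<Sum>l<n. N j l * x l))"
    unfolding sum_distrib_left sum_distrib_right by (subst sum.swap) (simp add: mult.assoc)
  then show "mv n (mm n M N) x k = mv n M (mv n N x) k"
    by (simp add: mv_def mm_def)
qed

lemma mv_adj_adj: "mv n (adj n (adj n M)) x = mv n M x"
  by (auto simp: adj_def mv_def intro!: ext)

lemma cinner_add_left: "cinner n (\<lambda>k. x k + y k) z = cinner n x z + cinner n y z"
  and cinner_add_right: "cinner n z (\<lambda>k. x k + y k) = cinner n z x + cinner n z y"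
  and cinner_diff_left: "cinner n (\<lambda>k. x k - y k) z = cinner n x z - cinner n y z"
  and cinner_diff_right: "cinner n z (\<lambda>k. x k - y k) = cinner n z x - cinner n z y"
  and cinner_scale_left: "cinner n (\<lambda>k. c * x k) z = cnj c * cinner n x z"
  and cinner_scale_right: "cinner n z (\<lambda>k. c * x k) = c * cinner n z x"
  and cinner_minus_right: "cinner n z (\<lambda>k. - x k) = - cinner n z x"
  and cinner_zero_left: "cinner n (\<lambda>_. 0) z = 0"
  and cinner_zero_right: "cinner n z (\<lambda>_. 0) = 0"
  by (auto simp: cinner_def algebra_simps sum.distrib sum_subtractf sum_distrib_left sum_negf)

lemmas cinner_simps = cinner_add_left cinner_add_right cinner_diff_left cinner_diff_right
  cinner_scale_left cinner_scale_right cinner_zero_left cinner_zero_right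

lemma cinner_commute: "cinner n y x = cnj (cinner n x y)"
  by (simp add: cinner_def mult.commute)

lemma cinner_adj: "cinner n x (mv n M y) = cinner n (mv n (adj n M) x) y"
proof -
  have "(\<Sum>k<n. cnj (x k) * (\<Sum>l<n. M k l * y l)) = (\<Sum>l<n. (\<Sum>k<n. M k l * cnj (x k)) * y l)"
    unfolding sum_distrib_left sum_distrib_right by (subst sum.swap) (simp add: ac_simps)
  then show ?thesis by (simp add: cinner_def mv_def adj_def)
qed

lemma cinner_adj': "cinner n (mv n M x) y = cinner n x (mv n (adj n M) y)"
  by (simp add: cinner_adj mv_adj_adj)

lemma cinner_self: "cinner n x x = of_real ((vnorm n x)\<^sup>2)"
proof -
  have "(vnorm n x)\<^sup>2 = (\<Sum>k<n. (cmod (x k))\<^sup>2)"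
    by (simp add: vnorm_def sum_nonneg)
  then show ?thesis
    unfolding cinner_def of_real_sum by (simp only: of_real_sum complex_norm_square mult.commute)
qed

lemma vnorm_eq_0: "x \<in> cvec n \<Longrightarrow> vnorm n x = 0 \<Longrightarrow> x = (\<lambda>_. 0)"
proof
  fix k
  assume "x \<in> cvec n" "vnorm n x = 0"
  then show "x k = 0"
    by (cases "k < n") (auto simp: vnorm_def cvec_def sum_nonneg_eq_0_iff)
qed

lemma cinner_self_eq_0: "x \<in> cvec n \<Longrightarrow> cinner n x x = 0 \<Longrightarrow> x = (\<lambda>_. 0)"
  by (auto simp: cinner_self intro: vnorm_eq_0)

lemma cvec_eqI:
  assumes "x \<in> cvec n" "y \<in> cvec n" "\<And>z. z \<in> cvec n \<Longrightarrow> cinner n z x = cinner n z y"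
  shows "x = y"
proof -
  have "(\<lambda>k. x k - y k) = (\<lambda>_. 0)"
    using assms by (intro cinner_self_eq_0[of _ n]) (auto simp: cvec_intros cinner_diff_right)
  then show ?thesis by (simp add: fun_eq_iff)
qed

definition std_vec :: "nat \<Rightarrow> nat \<Rightarrow> complex" where
  "std_vec l = (\<lambda>j. if j = l then 1 else 0)"

lemma std_vec_cvec: "l < n \<Longrightarrow> std_vec l \<in> cvec n"
  by (auto simp: std_vec_def cvec_def)

lemma mv_std_vec: "l < n \<Longrightarrow> k < n \<Longrightarrow> mv n M (std_vec l) k = M k l"
  by (simp add: mv_def std_vec_def if_distrib sum.delta cong: if_cong)

lemma cinner_std_vec: "l < n \<Longrightarrow> cinner n (std_vec l) x = x l"
  by (simp add: cinner_def std_vec_def if_distrib if_distribR sum.delta cong: if_cong)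

lemma cmat_eqI:
  assumes "M \<in> cmat n" "N \<in> cmat n" "\<And>x. x \<in> cvec n \<Longrightarrow> mv n M x = mv n N x"
  shows "M = N"
proof (intro ext)
  fix k l
  show "M k l = N k l"
    using assms std_vec_cvec[of l n] mv_std_vec[of l n k M] mv_std_vec[of l n k N]
    by (cases "k < n \<and> l < n") (auto simp: cmat_def)
qed

section \<open>Spectral theorem for Hermitian matrices\<close>

lemma hermitian_cinner: "hermitian n M \<Longrightarrow> cinner n x (mv n M y) = cinner n (mv n M x) y"
  by (simp add: cinner_adj hermitian_def)

text \<open>The span of the eigenvectors with real eigenvalues. Scaling is derivable, so the
  induction rule has just two cases: an eigenvector and a sum.\<close>

inductive_set eigsum :: "nat \<Rightarrow> (nat \<Rightarrow> nat \<Rightarrow> complex) \<Rightarrow> (nat \<Rightarrow> complex) set" for n M where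
  eig: "v \<in> cvec n \<Longrightarrow> mv n M v = (\<lambda>k. of_real a * v k) \<Longrightarrow> v \<in> eigsum n M"
| add: "x \<in> eigsum n M \<Longrightarrow> y \<in> eigsum n M \<Longrightarrow> (\<lambda>k. x k + y k) \<in> eigsum n M"

lemma eigsum_cvec: "x \<in> eigsum n M \<Longrightarrow> x \<in> cvec n"
  by (induction rule: eigsum.induct) (auto simp: cvec_intros)

lemma eigsum_zero: "(\<lambda>_. 0) \<in> eigsum n M"
  by (rule eigsum.eig[of _ _ _ 0]) (auto simp: cvec_intros mv_zero)

lemma eigsum_scale: "x \<in> eigsum n M \<Longrightarrow> (\<lambda>k. c * x k) \<in> eigsum n M"
proof (induction rule: eigsum.induct)
  case (eig v a)
  then show ?case by (intro eigsum.eig[of _ _ _ a]) (auto simp: cvec_intros mv_scale)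
next
  case (add x y)
  then show ?case using eigsum.add by (simp add: distrib_left)
qed

lemma eigsum_sum:
  "finite S \<Longrightarrow> (\<And>i. i \<in> S \<Longrightarrow> x i \<in> eigsum n M) \<Longrightarrow> (\<lambda>k. \<Sum>i\<in>S. c i * x i k) \<in> eigsum n M"
proof (induction S rule: finite_induct)
  case empty
  then show ?case by (simp add: eigsum_zero)
next
  case (insert i S)
  then have "(\<lambda>k. c i * x i k + (\<Sum>i\<in>S. c i * x i k)) \<in> eigsum n M"
    by (intro eigsum.add[of "\<lambda>k. c i * x i k"] eigsum_scale) auto
  with insert show ?case by simp
qed

text \<open>\<open>M - b\<close> is invertible on eigenvectors whose eigenvalue differs from
  \<open>b\<close> and zero on the others; the former supply \<open>u\<close>, the latter
  \<open>z\<close>.\<close>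

lemma eigsum_split:
  "y \<in> eigsum n M \<Longrightarrow> \<exists>u z. u \<in> eigsum n M \<and> z \<in> cvec n \<and> mv n M z = (\<lambda>k. b * z k) \<and>
     y = (\<lambda>k. mv n M u k - b * u k + z k)"
proof (induction rule: eigsum.induct)
  case (eig v a)
  show ?case
  proof (cases "of_real a = b")
    case True
    with eig show ?thesis
      by (intro exI[of _ "\<lambda>_. 0"] exI[of _ v]) (auto simp: eigsum_zero mv_zero)
  next
    case False
    have "v k = inverse (of_real a - b) * (of_real a * v k) - b * (inverse (of_real a - b) * v k)" for k
    proof -
      have "v k = inverse (of_real a - b) * ((of_real a - b) * v k)" using False by simp
      also have "\<dots> = inverse (of_real a - b) * (of_real a * v k) - b * (inverse (of_real a - b) * v k)"
        by (simp only: left_diff_distrib right_diff_distrib ac_simps)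
      finally show ?thesis .
    qed
    with False eig eigsum_scale[OF eigsum.eig[OF eig]] show ?thesis
      by (intro exI[of _ "\<lambda>k. inverse (of_real a - b) * v k"] exI[of _ "\<lambda>_. 0"])
         (auto simp: mv_scale mv_zero cvec_zero)
  qed
next
  case (add x y)
  then obtain u z u' z' where
    "u \<in> eigsum n M" "z \<in> cvec n" "mv n M z = (\<lambda>k. b * z k)" "x = (\<lambda>k. mv n M u k - b * u k + z k)"
    "u' \<in> eigsum n M" "z' \<in> cvec n" "mv n M z' = (\<lambda>k. b * z' k)" "y = (\<lambda>k. mv n M u' k - b * u' k + z' k)"
    by blast
  note * = this
  show ?case
  proof (intro exI conjI)
    show "(\<lambda>k. u k + u' k) \<in> eigsum n M" using * by (intro eigsum.add)
    show "(\<lambda>k. z k + z' k) \<in> cvec n" using * by (intro cvec_add)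
    show "mv n M (\<lambda>k. z k + z' k) = (\<lambda>k. b * (z k + z' k))"
      unfolding mv_add *(3,7) by (simp add: distrib_left)
    show "(\<lambda>k. x k + y k) = (\<lambda>k. mv n M (\<lambda>k. u k + u' k) k - b * (u k + u' k) + (z k + z' k))"
      unfolding mv_add *(4,8) by (simp add: algebra_simps)
  qed
qed

lemma hermitian_eigenvalue_real:
  assumes "hermitian n M" "v \<in> cvec n" "v \<noteq> (\<lambda>_. 0)" "mv n M v = (\<lambda>k. b * v k)"
  shows "cnj b = b"
proof -
  have "b * cinner n v v = cnj b * cinner n v v"
    using hermitian_cinner[OF assms(1), of v v] assms(4) by (simp add: cinner_simps)
  then show ?thesis using assms cinner_self_eq_0 by auto
qed

text \<open>A Hermitian matrix has no Jordan chains. Subtracting \<open>u\<close> from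
  \<open>x\<close> leaves \<open>y\<close> with \<open>M - b\<close> mapping \<open>y\<close> to
  \<open>z\<close> and \<open>z\<close> to 0. A nonzero \<open>z\<close> would make \<open>b\<close>
  real and hence be orthogonal to the range of \<open>M - b\<close>, thus to itself.\<close>

lemma eigsum_lift:
  assumes M: "hermitian n M" and x: "x \<in> cvec n" and "(\<lambda>k. mv n M x k - b * x k) \<in> eigsum n M"
  shows "x \<in> eigsum n M"
proof -
  obtain u z where u: "u \<in> eigsum n M" and z: "z \<in> cvec n" "mv n M z = (\<lambda>k. b * z k)" and
    eq: "(\<lambda>k. mv n M x k - b * x k) = (\<lambda>k. mv n M u k - b * u k + z k)"
    using eigsum_split[OF assms(3)] by blast
  define y where "y = (\<lambda>k. x k - u k)"
  have y: "y \<in> cvec n" using x eigsum_cvec[OF u] by (simp add: y_def cvec_intros)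
  have My: "mv n M y = (\<lambda>k. b * y k + z k)"
    using fun_cong[OF eq] by (auto simp: y_def mv_diff algebra_simps intro!: ext)
  have "z = (\<lambda>_. 0)"
  proof (rule ccontr)
    assume nz: "z \<noteq> (\<lambda>_. 0)"
    have "cnj b = b" by (rule hermitian_eigenvalue_real[OF M z(1) nz z(2)])
    moreover have "cinner n z (mv n M y) = b * cinner n z y + cinner n z z"
      by (simp add: My cinner_simps)
    moreover have "cinner n z (mv n M y) = cnj b * cinner n z y"
      by (simp add: hermitian_cinner[OF M] z(2) cinner_simps)
    ultimately have "cinner n z z = 0" by simp
    then show False using cinner_self_eq_0[OF z(1)] nz by simp
  qed
  with My have My: "mv n M y = (\<lambda>k. b * y k)" by simp
  \<comment> \<open>Only a nonzero eigenvector forces \<open>b\<close> to be real, as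
    \<open>eigsum\<close> demands; hence the separate case \<open>y = 0\<close>.\<close>
  have "y \<in> eigsum n M"
  proof (cases "y = (\<lambda>_. 0)")
    case True
    then show ?thesis by (simp add: eigsum_zero)
  next
    case False
    then have "b = of_real (Re b)"
      using hermitian_eigenvalue_real[OF M y _ My] by (simp add: complex_eq_iff)
    then show ?thesis using My y by (metis eigsum.eig)
  qed
  then have "(\<lambda>k. y k + u k) \<in> eigsum n M" using u by (rule eigsum.add)
  then show ?thesis by (simp add: y_def)
qed

text \<open>The columns of a triangularizing basis lie in \<open>eigsum\<close> one after the other, since \<open>M - b\<close> for the
  diagonal entry \<open>b\<close> maps each of them into the span of its predecessors.\<close>
theorem eigsum_hermitian:
  assumes M: "hermitian n M"
  shows "eigsum n M = cvec n"
proof (intro equalityI subsetI)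
  fix x assume "x \<in> cvec n"
  define A where "A = Matrix.mat n n (\<lambda>(i, j). M i j)"
  have A: "A \<in> carrier_mat n n" by (simp add: A_def)
  obtain as where "char_poly A = (\<Prod>a\<leftarrow>as. [:- a, 1:])" using char_poly_factorized[OF A] by blast
  then obtain B P Q where ut: "upper_triangular B" and wit: "similar_mat_wit A B P Q"
    using schur_decomposition_exists[OF A] unfolding similar_mat_def by blast
  note PQ = similar_mat_witD2[OF A wit]
  have "A * P = P * B * (Q * P)"
    using PQ A by (simp add: assoc_mult_mat[of _ n n _ n _ n])
  then have AP: "A * P = P * B" using PQ by simp
  define p where "p j = (\<lambda>k. if k < n then P $$ (k, j) else 0)" for j
  have p_cvec: "p j \<in> cvec n" for j by (simp add: p_def cvec_def)
  have "p j \<in> eigsum n M" if "j < n" for j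
    using that
  proof (induction j rule: less_induct)
    case (less j)
    \<comment> \<open>Column \<open>j\<close> of \<open>A * P = P * B\<close>: the entries of
      \<open>B\<close> below the diagonal vanish and the diagonal term moves to the left.\<close>
    have "mv n M (p j) k - B $$ (j, j) * p j k = (\<Sum>i<j. B $$ (i, j) * p i k)" for k
    proof (cases "k < n")
      case True
      have "(\<Sum>l<n. M k l * P $$ (l, j)) = (A * P) $$ (k, j)"
        using PQ(5,6) True less.prems by (simp add: A_def scalar_prod_def atLeast0LessThan)
      also have "\<dots> = (\<Sum>i<n. P $$ (k, i) * B $$ (i, j))"
        unfolding AP using PQ(5,6) True less.prems by (simp add: scalar_prod_def atLeast0LessThan)
      also have "\<dots> = (\<Sum>i<Suc j. P $$ (k, i) * B $$ (i, j))"
        using less.prems PQ(5) upper_triangularD[OF ut] by (intro sum.mono_neutral_right) auto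
      finally show ?thesis
        using True by (simp add: mv_def p_def mult.commute)
    qed (simp add: mv_def p_def)
    then have "(\<lambda>k. mv n M (p j) k - B $$ (j, j) * p j k) = (\<lambda>k. \<Sum>i<j. B $$ (i, j) * p i k)" by auto
    also have "\<dots> \<in> eigsum n M" using less by (intro eigsum_sum) auto
    finally show ?case by (rule eigsum_lift[OF M p_cvec])
  qed
  \<comment> \<open>Since \<open>P * Q\<close> is the identity, \<open>Q\<close> applied to
    \<open>x\<close> gives the coordinates of \<open>x\<close> in the columns of
    \<open>P\<close>.\<close>
  then have "(\<lambda>k. \<Sum>j<n. (\<Sum>l<n. Q $$ (j, l) * x l) * p j k) \<in> eigsum n M"
    by (intro eigsum_sum) auto
  moreover have "(\<Sum>j<n. (\<Sum>l<n. Q $$ (j, l) * x l) * p j k) = x k" for k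
  proof (cases "k < n")
    case True
    have "(\<Sum>j<n. (\<Sum>l<n. Q $$ (j, l) * x l) * p j k) = (\<Sum>l<n. (\<Sum>j<n. P $$ (k, j) * Q $$ (j, l)) * x l)"
      unfolding sum_distrib_right using True by (subst sum.swap) (simp add: p_def ac_simps)
    also have "\<dots> = (\<Sum>l<n. (P * Q) $$ (k, l) * x l)"
      using PQ(6,7) True by (intro sum.cong) (auto simp: scalar_prod_def atLeast0LessThan)
    also have "\<dots> = (\<Sum>l<n. if k = l then x l else 0)"
      unfolding PQ(1) using True by (intro sum.cong) auto
    also have "\<dots> = x k" using True by simp
    finally show ?thesis .
  qed (use \<open>x \<in> cvec n\<close> in \<open>auto simp: p_def cvec_def\<close>)
  ultimately show "x \<in> eigsum n M" by simp
qed (rule eigsum_cvec)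

text \<open>Since the eigenvectors of \<open>M\<close> span, identities between functions of
  \<open>M\<close> reduce to identities between functions of a real eigenvalue.\<close>

lemma mat_eqI_eig:
  assumes M: "hermitian n M" and "P \<in> cmat n" "Q \<in> cmat n"
    and eq: "\<And>v a. \<lbrakk>v \<in> cvec n; mv n M v = (\<lambda>k. of_real a * v k)\<rbrakk> \<Longrightarrow> mv n P v = mv n Q v"
  shows "P = Q"
proof (rule cmat_eqI[OF assms(2,3)])
  fix x assume "x \<in> cvec n"
  then have "x \<in> eigsum n M" using eigsum_hermitian[OF M] by simp
  then show "mv n P x = mv n Q x"
    by (induction rule: eigsum.induct) (auto simp: eq mv_add)
qed

section \<open>Kernel of a matrix and range of its adjoint\<close>

lemma mm_cmat: "mm n M N \<in> cmat n"
  by (auto simp: mm_def cmat_def)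

lemma adj_mm: "adj n (mm n M N) = mm n (adj n N) (adj n M)"
  by (auto simp: adj_def mm_def mult.commute intro!: ext sum.cong)

lemma hermitian_adj_mm: "hermitian n (mm n (adj n B) B)"
  unfolding hermitian_def
  by (auto simp: mm_cmat) (auto simp: adj_def mm_def mult.commute intro!: ext)

lemma ker_adj_orth: "w \<in> ker n B \<Longrightarrow> cinner n w (mv n (adj n B) u) = 0"
  by (simp add: cinner_adj mv_adj_adj ker_def cinner_zero_left)

lemma ker_add: "w \<in> ker n B \<Longrightarrow> w' \<in> ker n B \<Longrightarrow> (\<lambda>k. w k + w' k) \<in> ker n B"
  and ker_diff: "w \<in> ker n B \<Longrightarrow> w' \<in> ker n B \<Longrightarrow> (\<lambda>k. w k - w' k) \<in> ker n B"
  and ker_scale: "w \<in> ker n B \<Longrightarrow> (\<lambda>k. c * w k) \<in> ker n B"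
  by (auto simp: ker_def cvec_intros mv_add mv_diff mv_scale)

text \<open>Read off from the eigenvectors \<open>v\<close> of \<open>B\<^sup>\<dagger>B\<close>:
  eigenvalue 0 forces \<open>Bv\<close> to have norm 0, and for an eigenvalue
  \<open>a \<noteq> 0\<close> the vector \<open>v\<close> is the image of \<open>Bv / a\<close>
  under the adjoint.\<close>

lemma ker_ran_decomposition:
  assumes "x \<in> cvec n"
  shows "\<exists>w u. w \<in> ker n B \<and> u \<in> cvec n \<and> x = (\<lambda>k. w k + mv n (adj n B) u k)"
proof -
  have "x \<in> eigsum n (mm n (adj n B) B)"
    using assms eigsum_hermitian[OF hermitian_adj_mm] by simp
  then show ?thesis
  proof (induction rule: eigsum.induct)
    case (eig v a)
    then have v: "mv n (adj n B) (mv n B v) = (\<lambda>k. of_real a * v k)" by (simp add: mv_mm)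
    show ?case
    proof (cases "a = 0")
      case True
      then have "cinner n (mv n B v) (mv n B v) = 0"
        using v by (simp add: cinner_adj' cinner_zero_right)
      then have "mv n B v = (\<lambda>_. 0)" by (rule cinner_self_eq_0[OF cvec_mv])
      with eig show ?thesis
        by (intro exI[of _ v] exI[of _ "\<lambda>_. 0"]) (auto simp: ker_def cvec_zero mv_zero)
    next
      case False
      then have "v = (\<lambda>k. 0 + mv n (adj n B) (\<lambda>k. inverse (of_real a) * mv n B v k) k)"
        unfolding mv_scale v by (simp add: mult.assoc[symmetric])
      moreover have "(\<lambda>_. 0) \<in> ker n B" by (simp add: ker_def cvec_zero mv_zero)
      ultimately show ?thesis using cvec_scale[OF cvec_mv] by blast
    qed
  next
    case (add x y)
    then obtain w u w' u' where
      "w \<in> ker n B" "u \<in> cvec n" "x = (\<lambda>k. w k + mv n (adj n B) u k)"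
      "w' \<in> ker n B" "u' \<in> cvec n" "y = (\<lambda>k. w' k + mv n (adj n B) u' k)" by blast
    then show ?case
      by (intro exI[of _ "\<lambda>k. w k + w' k"] exI[of _ "\<lambda>k. u k + u' k"])
         (simp add: ker_add cvec_add mv_add algebra_simps)
  qed
qed

section \<open>Matrices from symmetric relations, functional calculus\<close>

lemma symmetric_relation_functional:
  assumes dom: "\<And>x y. R x y \<Longrightarrow> x \<in> cvec n \<and> y \<in> cvec n"
    and tot: "\<And>x. x \<in> cvec n \<Longrightarrow> \<exists>y. R x y"
    and sym: "\<And>x y x' y'. R x y \<Longrightarrow> R x' y' \<Longrightarrow> cinner n x y' = cinner n y x'"
    and "R x y" "R x y'"
  shows "y = y'"
proof (rule cvec_eqI)
  show "y \<in> cvec n" "y' \<in> cvec n" using assms by blast+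
  \<comment> \<open>Symmetry computes the inner product of \<open>z\<close> with any image of
    \<open>x\<close> from an image of \<open>z\<close>, so both images have the same inner
    products.\<close>
  fix z assume "z \<in> cvec n"
  then obtain z' where "R z z'" using tot by blast
  then show "cinner n z y = cinner n z y'" using sym assms(4,5) by metis
qed

text \<open>Used twice, for functions of a Hermitian matrix and for \<open>L\<close>; both are
  easier to describe by their graphs. Any images of the standard vectors serve as columns: linearity
  extends the relation to all vectors, and symmetry makes the matrix Hermitian.\<close>

lemma symmetric_relation_matrix:
  assumes dom: "\<And>x y. R x y \<Longrightarrow> x \<in> cvec n \<and> y \<in> cvec n"
    and tot: "\<And>x. x \<in> cvec n \<Longrightarrow> \<exists>y. R x y"
    and add: "\<And>x y x' y'. R x y \<Longrightarrow> R x' y' \<Longrightarrow> R (\<lambda>k. x k + x' k) (\<lambda>k. y k + y' k)"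
    and scale: "\<And>x y c. R x y \<Longrightarrow> R (\<lambda>k. c * x k) (\<lambda>k. c * y k)"
    and sym: "\<And>x y x' y'. R x y \<Longrightarrow> R x' y' \<Longrightarrow> cinner n x y' = cinner n y x'"
  shows "\<exists>M. hermitian n M \<and> (\<forall>x\<in>cvec n. R x (mv n M x))"
proof -
  obtain F where F: "\<And>x. x \<in> cvec n \<Longrightarrow> R x (F x)" using tot by metis
  define M where "M k l = (if k < n \<and> l < n then F (std_vec l) k else 0)" for k l
  have zero: "R (\<lambda>_. 0) (\<lambda>_. 0)"
    using scale[OF F[OF cvec_zero], of 0] by simp
  have RM: "R x (mv n M x)" if x: "x \<in> cvec n" for x
  proof -
    have "R (\<lambda>k. \<Sum>l\<in>S. x l * std_vec l k) (\<lambda>k. \<Sum>l\<in>S. x l * F (std_vec l) k)"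
      if "finite S" "S \<subseteq> {..<n}" for S
      using that
    proof (induction S rule: finite_induct)
      case empty
      then show ?case by (simp add: zero)
    next
      case (insert l S)
      then have "R (\<lambda>k. x l * std_vec l k + (\<Sum>l\<in>S. x l * std_vec l k))
          (\<lambda>k. x l * F (std_vec l) k + (\<Sum>l\<in>S. x l * F (std_vec l) k))"
        by (intro add scale F std_vec_cvec) auto
      with insert show ?case by simp
    qed
    then have "R (\<lambda>k. \<Sum>l<n. x l * std_vec l k) (\<lambda>k. \<Sum>l<n. x l * F (std_vec l) k)" by blast
    moreover have "(\<lambda>k. \<Sum>l<n. x l * std_vec l k) = x"
    proof
      fix k
      show "(\<Sum>l<n. x l * std_vec l k) = x k"
        using x by (cases "k < n") (auto simp: std_vec_def if_distrib cvec_def sum.delta' cong: if_cong)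
    qed
    moreover have "(\<Sum>l<n. x l * F (std_vec l) k) = mv n M x k" for k
    proof (cases "k < n")
      case True
      then show ?thesis by (simp add: mv_def M_def mult.commute)
    next
      case False
      have "F (std_vec l) k = 0" if "l < n" for l
        using dom[OF F[OF std_vec_cvec[OF that]]] False by (simp add: cvec_def)
      with False show ?thesis by (simp add: mv_def)
    qed
    ultimately show ?thesis by simp
  qed
  moreover have "hermitian n M"
    unfolding hermitian_def
  proof (intro conjI ext)
    show "M \<in> cmat n" by (auto simp: cmat_def M_def)
    fix k l
    show "adj n M k l = M k l"
    proof (cases "k < n \<and> l < n")
      case True
      then have "cinner n (std_vec k) (mv n M (std_vec l)) = cinner n (mv n M (std_vec k)) (std_vec l)"
        using sym RM std_vec_cvec by blast
      then show ?thesis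
        using True by (simp add: cinner_std_vec mv_std_vec cinner_commute[of n "mv n M (std_vec k)"] adj_def)
    qed (auto simp: adj_def M_def)
  qed
  ultimately show ?thesis by blast
qed

text \<open>The graph of g(M), generated from eigenvectors. A relation avoids choosing among the
  many decompositions of a vector into eigenvectors.\<close>

inductive fun_calc :: "nat \<Rightarrow> (nat \<Rightarrow> nat \<Rightarrow> complex) \<Rightarrow> (real \<Rightarrow> real) \<Rightarrow> (nat \<Rightarrow> complex) \<Rightarrow> (nat \<Rightarrow> complex) \<Rightarrow> bool"
  for n M g where
  eig: "v \<in> cvec n \<Longrightarrow> mv n M v = (\<lambda>k. of_real a * v k) \<Longrightarrow> fun_calc n M g v (\<lambda>k. of_real (g a) * v k)"
| add: "fun_calc n M g x y \<Longrightarrow> fun_calc n M g x' y' \<Longrightarrow> fun_calc n M g (\<lambda>k. x k + x' k) (\<lambda>k. y k + y' k)"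

lemma fun_calc_cvec: "fun_calc n M g x y \<Longrightarrow> x \<in> cvec n \<and> y \<in> cvec n"
  by (induction rule: fun_calc.induct) (auto simp: cvec_intros)

lemma fun_calc_scale: "fun_calc n M g x y \<Longrightarrow> fun_calc n M g (\<lambda>k. c * x k) (\<lambda>k. c * y k)"
proof (induction rule: fun_calc.induct)
  case (eig v a)
  have "fun_calc n M g (\<lambda>k. c * v k) (\<lambda>k. of_real (g a) * (c * v k))"
    using eig by (intro fun_calc.eig) (auto simp: cvec_intros mv_scale)
  then show ?case by (simp add: ac_simps)
next
  case (add x y x' y')
  then show ?case using fun_calc.add by (simp add: distrib_left)
qed

text \<open>Eigenvectors for different eigenvalues are orthogonal, so only the components of
  \<open>x\<close> with eigenvalue \<open>a\<close> contribute.\<close>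

lemma fun_calc_sym_eig:
  assumes M: "hermitian n M" and v: "v \<in> cvec n" "mv n M v = (\<lambda>k. of_real a * v k)"
  shows "fun_calc n M g x y \<Longrightarrow> cinner n v y = of_real (g a) * cinner n v x"
proof (induction rule: fun_calc.induct)
  case (eig w b)
  have "of_real b * cinner n v w = of_real a * cinner n v w"
    using hermitian_cinner[OF M, of v w] v eig by (simp add: cinner_simps)
  then show ?case by (cases "a = b") (auto simp: cinner_simps)
qed (simp add: cinner_simps algebra_simps)

lemma fun_calc_sym:
  assumes M: "hermitian n M" and "fun_calc n M g x y" "fun_calc n M g x' y'"
  shows "cinner n x y' = cinner n y x'"
  using assms(2)
proof (induction rule: fun_calc.induct)
  case (eig v a)
  then show ?case using fun_calc_sym_eig[OF M eig assms(3)] by (simp add: cinner_simps)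
qed (simp add: cinner_simps)

lemma fun_calc_total:
  assumes "hermitian n M" "x \<in> cvec n" shows "\<exists>y. fun_calc n M g x y"
proof -
  have "x \<in> eigsum n M" using assms eigsum_hermitian by simp
  then show ?thesis by (induction rule: eigsum.induct) (blast intro: fun_calc.intros)+
qed

lemma functional_calculus:
  assumes M: "hermitian n M"
  shows "\<exists>P. hermitian n P \<and> (\<forall>v a. v \<in> cvec n \<longrightarrow> mv n M v = (\<lambda>k. of_real a * v k)
     \<longrightarrow> mv n P v = (\<lambda>k. of_real (g a) * v k))"
proof -
  have "\<exists>P. hermitian n P \<and> (\<forall>x\<in>cvec n. fun_calc n M g x (mv n P x))"
    by (rule symmetric_relation_matrix)
       (blast intro: fun_calc_total[OF M] fun_calc.add fun_calc_scale fun_calc_sym[OF M] dest: fun_calc_cvec)+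
  then obtain P where "hermitian n P" and P: "\<forall>x\<in>cvec n. fun_calc n M g x (mv n P x)" by blast
  have func: "y = y'" if "fun_calc n M g x y" "fun_calc n M g x y'" for x y y'
    by (rule symmetric_relation_functional[where R = "fun_calc n M g", OF _ _ _ that])
       (blast intro: fun_calc_total[OF M] fun_calc_sym[OF M] dest: fun_calc_cvec)+
  have "mv n P v = (\<lambda>k. of_real (g a) * v k)" if "v \<in> cvec n" "mv n M v = (\<lambda>k. of_real a * v k)" for v a
    using func[OF P[rule_format] fun_calc.eig] that by blast
  with \<open>hermitian n P\<close> show ?thesis by blast
qed

text \<open>\<open>P\<close> is the square of the Hermitian matrix \<open>S\<close> obtained from
  the root of \<open>g\<close>, so its quadratic form is the squared norm of \<open>S\<close>
  applied to the vector.\<close>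

lemma functional_calculus_psd:
  assumes M: "hermitian n M" and g: "\<And>a. 0 \<le> g a"
  shows "\<exists>P. psd n P \<and> (\<forall>v a. v \<in> cvec n \<longrightarrow> mv n M v = (\<lambda>k. of_real a * v k)
     \<longrightarrow> mv n P v = (\<lambda>k. of_real (g a) * v k))"
proof -
  obtain P where P: "hermitian n P" "\<forall>v a. v \<in> cvec n \<longrightarrow> mv n M v = (\<lambda>k. of_real a * v k)
     \<longrightarrow> mv n P v = (\<lambda>k. of_real (g a) * v k)"
    using functional_calculus[OF M] by blast
  obtain S where S: "hermitian n S" "\<forall>v a. v \<in> cvec n \<longrightarrow> mv n M v = (\<lambda>k. of_real a * v k)
     \<longrightarrow> mv n S v = (\<lambda>k. of_real (sqrt (g a)) * v k)"
    using functional_calculus[OF M, of "\<lambda>a. sqrt (g a)"] by blast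
  have "P = mm n S S"
  proof (rule mat_eqI_eig[OF M _ mm_cmat])
    fix v a assume v: "v \<in> cvec n" "mv n M v = (\<lambda>k. of_real a * v k)"
    have "complex_of_real (sqrt (g a)) * complex_of_real (sqrt (g a)) = of_real (g a)"
      using g[of a] by (simp flip: of_real_mult)
    then show "mv n P v = mv n (mm n S S) v"
      using P(2) S(2) v by (simp add: mv_mm mv_scale mult.assoc[symmetric])
  qed (use P(1) in \<open>simp add: hermitian_def\<close>)
  then have "cinner n x (mv n P x) = cinner n (mv n S x) (mv n S x)" for x
    using hermitian_cinner[OF S(1), of x "mv n S x"] by (simp add: mv_mm)
  then have "psd n P" using P(1) by (simp add: psd_def cinner_self)
  with P(2) show ?thesis by blast
qed

text \<open>Uniqueness of the positive part, tested on an eigenvector. \<open>PN = 0\<close> makes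
  \<open>Pv\<close> and \<open>Nv\<close> orthogonal; pairing \<open>Pv - Nv = av\<close> with each
  of them expresses their squared norms as \<open>a\<close> and \<open>- a\<close> times nonnegative
  numbers, so the one with the wrong sign vanishes.\<close>

lemma psd_eig_unique:
  assumes P: "psd n P" and N: "psd n N" and PN: "mm n P N = (\<lambda>_ _. 0)"
    and v: "v \<in> cvec n" "\<And>k. mv n P v k - mv n N v k = of_real a * v k"
  shows "mv n P v = (\<lambda>k. of_real (max a 0) * v k)"
proof -
  have herm: "hermitian n P" "hermitian n N" using P N by (auto simp: psd_def)
  have "mv n P (mv n N v) = (\<lambda>_. 0)"
    unfolding mv_mm[symmetric] PN by (simp add: mv_def fun_eq_iff)
  then have orth: "cinner n (mv n P v) (mv n N v) = 0" "cinner n (mv n N v) (mv n P v) = 0"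
    using hermitian_cinner[OF herm(1), of v "mv n N v"] cinner_commute[of n "mv n N v" "mv n P v"]
    by (auto simp: cinner_zero_right)
  have "mv n P v = (\<lambda>k. mv n N v k + of_real a * v k)"
    using v(2) by (auto simp: algebra_simps intro!: ext)
  from arg_cong[OF this, of "cinner n (mv n P v)"]
  have "cinner n (mv n P v) (mv n P v) = of_real a * cinner n v (mv n P v)"
    using hermitian_cinner[OF herm(1), of v v] by (simp only: cinner_simps orth add_0)
  then have "(vnorm n (mv n P v))\<^sup>2 = a * Re (cinner n v (mv n P v))"
    by (simp add: cinner_self complex_eq_iff)
  moreover have "mv n N v = (\<lambda>k. mv n P v k - of_real a * v k)"
    using v(2) by (auto simp: algebra_simps intro!: ext)
  from arg_cong[OF this, of "cinner n (mv n N v)"]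
  have "cinner n (mv n N v) (mv n N v) = - of_real a * cinner n v (mv n N v)"
    using hermitian_cinner[OF herm(2), of v v] by (simp only: cinner_simps orth diff_0 mult_minus_left)
  then have "(vnorm n (mv n N v))\<^sup>2 = - a * Re (cinner n v (mv n N v))"
    by (simp add: cinner_self complex_eq_iff)
  moreover have "0 \<le> Re (cinner n v (mv n P v))" "0 \<le> Re (cinner n v (mv n N v))"
    using P N v(1) by (auto simp: psd_def)
  ultimately have "a \<le> 0 \<Longrightarrow> (vnorm n (mv n P v))\<^sup>2 \<le> 0" "0 \<le> a \<Longrightarrow> (vnorm n (mv n N v))\<^sup>2 \<le> 0"
    by (simp_all add: mult_nonpos_nonneg)
  then have "a \<le> 0 \<Longrightarrow> mv n P v = (\<lambda>_. 0)" "0 \<le> a \<Longrightarrow> mv n N v = (\<lambda>_. 0)"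
    using vnorm_eq_0[OF cvec_mv] by auto
  then show ?thesis
    using v(2) by (cases "0 \<le> a") (auto simp: max_def)
qed

text \<open>The functional calculus with \<open>max a 0\<close> and \<open>max (- a) 0\<close>
  provides a decomposition, and comparison on eigenvectors shows that it is the only one with
  product zero; hence the definite description denotes.\<close>

lemma pos_part_decomposition:
  assumes M: "hermitian n M"
  shows "\<exists>N. psd n (pos_part n M) \<and> psd n N \<and> M = (\<lambda>k l. pos_part n M k l - N k l)"
proof -
  obtain P where P: "psd n P" "\<forall>v a. v \<in> cvec n \<longrightarrow> mv n M v = (\<lambda>k. of_real a * v k)
     \<longrightarrow> mv n P v = (\<lambda>k. of_real (max a 0) * v k)"
    using functional_calculus_psd[OF M, of "\<lambda>a. max a 0"] by auto
  obtain N where N: "psd n N" "\<forall>v a. v \<in> cvec n \<longrightarrow> mv n M v = (\<lambda>k. of_real a * v k)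
     \<longrightarrow> mv n N v = (\<lambda>k. of_real (max (- a) 0) * v k)"
    using functional_calculus_psd[OF M, of "\<lambda>a. max (- a) 0"] by auto
  have sub: "mv n (\<lambda>k l. P k l - N k l) x k = mv n P x k - mv n N x k" for P N x k
    by (simp add: mv_def sum_subtractf algebra_simps)
  have cm: "M \<in> cmat n" "P \<in> cmat n" "N \<in> cmat n" using M P(1) N(1) by (auto simp: psd_def hermitian_def)
  have MPN: "M = (\<lambda>k l. P k l - N k l)"
  proof (rule mat_eqI_eig[OF M])
    fix v a assume v: "v \<in> cvec n" "mv n M v = (\<lambda>k. of_real a * v k)"
    have *: "complex_of_real (max a 0) - of_real (max (- a) 0) = of_real a"
      by (simp add: max_def)
    show "mv n M v = mv n (\<lambda>k l. P k l - N k l) v"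
      unfolding fun_eq_iff sub P(2)[rule_format, OF v] N(2)[rule_format, OF v] v(2)
      by (intro allI) (simp only: left_diff_distrib[symmetric] *)
  qed (use cm in \<open>auto simp: cmat_def\<close>)
  have PN: "mm n P N = (\<lambda>_ _. 0)"
  proof (rule mat_eqI_eig[OF M mm_cmat])
    fix v a assume v: "v \<in> cvec n" "mv n M v = (\<lambda>k. of_real a * v k)"
    have "complex_of_real (max a 0) * of_real (max (- a) 0) = 0" by (simp add: max_def)
    then have "mv n P (mv n N v) k = 0" for k
      using P(2) N(2) v by (auto simp: mv_scale)
    then show "mv n (mm n P N) v = mv n (\<lambda>_ _. 0) v"
      by (auto simp: mv_mm mv_def[of n "\<lambda>_ _. 0"])
  qed (auto simp: cmat_def)
  have "pos_part n M = P"
    unfolding pos_part_def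
  proof (rule the_equality)
    show "\<exists>N. psd n P \<and> psd n N \<and> M = (\<lambda>k l. P k l - N k l) \<and> mm n P N = (\<lambda>_ _. 0)"
      using P(1) N(1) MPN PN by blast
    fix P' assume "\<exists>N. psd n P' \<and> psd n N \<and> M = (\<lambda>k l. P' k l - N k l) \<and> mm n P' N = (\<lambda>_ _. 0)"
    then obtain N' where P': "psd n P'" "psd n N'" "M = (\<lambda>k l. P' k l - N' k l)" "mm n P' N' = (\<lambda>_ _. 0)"
      by blast
    show "P' = P"
    proof (rule mat_eqI_eig[OF M])
      fix v a assume v: "v \<in> cvec n" "mv n M v = (\<lambda>k. of_real a * v k)"
      then have "mv n P' v k - mv n N' v k = of_real a * v k" for k
        unfolding sub[symmetric] P'(3)[symmetric] by simp
      then show "mv n P' v = mv n P v"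
        using psd_eig_unique[OF P'(1,2,4) v(1)] P(2) v by simp
    qed (use P'(1) P(1) in \<open>auto simp: psd_def hermitian_def\<close>)
  qed
  then show ?thesis using P(1) N(1) MPN by blast
qed

section \<open>Operator norm and quadratic form\<close>

lemma vnorm_L2_set: "vnorm n x = L2_set (\<lambda>k. cmod (x k)) {..<n}"
  by (simp add: vnorm_def L2_set_def)

lemma Re_cinner_le: "Re (cinner n x y) \<le> vnorm n x * vnorm n y"
proof -
  have "Re (cinner n x y) \<le> (\<Sum>k<n. cmod (cnj (x k) * y k))"
    unfolding cinner_def using complex_Re_le_cmod norm_sum order_trans by blast
  also have "\<dots> = (\<Sum>k<n. \<bar>cmod (x k)\<bar> * \<bar>cmod (y k)\<bar>)" by (simp add: norm_mult)
  also have "\<dots> \<le> vnorm n x * vnorm n y"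
    unfolding vnorm_L2_set by (rule L2_set_mult_ineq)
  finally show ?thesis .
qed

lemma vnorm_scale: "vnorm n (\<lambda>k. c * x k) = cmod c * vnorm n x"
  by (simp add: vnorm_def norm_mult power_mult_distrib sum_distrib_left[symmetric] real_sqrt_mult)

text \<open>The supremum must be shown to range over a bounded set: coordinates of a unit ball
  vector have modulus at most 1, so row sums of moduli bound its image.\<close>

lemma opnorm_upper:
  assumes "x \<in> cvec n" "vnorm n x \<le> 1"
  shows "vnorm n (mv n M x) \<le> opnorm n M"
  unfolding opnorm_def
proof (rule cSup_upper)
  show "bdd_above {vnorm n (mv n M x) |x. x \<in> cvec n \<and> vnorm n x \<le> 1}"
  proof (rule bdd_aboveI, safe)
    fix x assume "vnorm n x \<le> 1"
    have "cmod (x l) \<le> 1" if "l < n" for l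
      using member_le_L2_set[of "{..<n}" l "\<lambda>k. cmod (x k)"] that \<open>vnorm n x \<le> 1\<close>
      by (simp add: vnorm_L2_set)
    then have "cmod (mv n M x k) \<le> (\<Sum>l<n. cmod (M k l))" if "k < n" for k
      using that by (auto simp: mv_def norm_mult intro!: order_trans[OF norm_sum] sum_mono mult_left_le)
    then show "vnorm n (mv n M x) \<le> L2_set (\<lambda>k. \<Sum>l<n. cmod (M k l)) {..<n}"
      unfolding vnorm_L2_set by (intro L2_set_mono) auto
  qed
qed (use assms in blast)

lemma opnorm_nonneg: "0 \<le> opnorm n M"
  using opnorm_upper[of "\<lambda>_. 0" n M] by (simp add: cvec_zero mv_zero vnorm_def)

lemma vnorm_mv_le:
  assumes "x \<in> cvec n" shows "vnorm n (mv n M x) \<le> opnorm n M * vnorm n x"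
proof (cases "vnorm n x = 0")
  case True
  then show ?thesis using vnorm_eq_0[OF assms] by (simp add: mv_zero vnorm_def)
next
  case False
  then have pos: "0 < vnorm n x" by (simp add: vnorm_L2_set order_less_le)
  have "vnorm n (mv n M (\<lambda>k. of_real (inverse (vnorm n x)) * x k)) \<le> opnorm n M"
    using assms pos by (intro opnorm_upper) (auto simp: cvec_scale vnorm_scale norm_inverse)
  then have "inverse (vnorm n x) * vnorm n (mv n M x) \<le> opnorm n M"
    using pos unfolding mv_scale vnorm_scale by (simp add: norm_inverse)
  then show ?thesis using pos by (simp add: field_simps)
qed

text \<open>Discarding the negative part can only increase the form; Cauchy-Schwarz bounds what
  remains.\<close>

lemma quadratic_form_le_pos_part:
  assumes M: "hermitian n M" and x: "x \<in> cvec n"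
  shows "Re (cinner n x (mv n M x)) \<le> opnorm n (pos_part n M) * (vnorm n x)\<^sup>2"
proof -
  obtain N where N: "psd n N" "M = (\<lambda>k l. pos_part n M k l - N k l)"
    using pos_part_decomposition[OF M] by blast
  have "mv n M x = (\<lambda>k. mv n (pos_part n M) x k - mv n N x k)"
    by (subst N(2)) (auto simp: mv_def sum_subtractf algebra_simps)
  then have "Re (cinner n x (mv n M x)) \<le> Re (cinner n x (mv n (pos_part n M) x))"
    using N(1) x by (simp add: cinner_diff_right psd_def)
  also have "\<dots> \<le> vnorm n x * (opnorm n (pos_part n M) * vnorm n x)"
    using vnorm_mv_le[OF x] by (intro order_trans[OF Re_cinner_le] mult_left_mono) (auto simp: vnorm_L2_set)
  finally show ?thesis by (simp add: power2_eq_square ac_simps)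
qed

section \<open>Boundary conditions\<close>

definition mtr :: "(nat \<Rightarrow> nat \<Rightarrow> complex) \<Rightarrow> nat \<Rightarrow> nat \<Rightarrow> complex" where
  "mtr C k l = C l k"

lemma injective_iff_det:
  "(\<forall>u\<in>cvec n. mv n C u = (\<lambda>_. 0) \<longrightarrow> u = (\<lambda>_. 0)) \<longleftrightarrow>
     Determinant.det (Matrix.mat n n (\<lambda>(i, j). C i j)) \<noteq> 0" (is "?inj \<longleftrightarrow> Determinant.det ?C \<noteq> 0")
proof -
  have mult: "(?C *\<^sub>v v) = Matrix.vec n (mv n C (\<lambda>k. if k < n then vec_index v k else 0))"
    if "v \<in> carrier_vec n" for v
    using that by (auto simp: mv_def scalar_prod_def atLeast0LessThan intro!: eq_vecI)
  have "Determinant.det ?C = 0 \<longleftrightarrow> (\<exists>v. v \<in> carrier_vec n \<and> v \<noteq> 0\<^sub>v n \<and> ?C *\<^sub>v v = 0\<^sub>v n)"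
    by (rule det_0_iff_vec_prod_zero_field) simp
  also have "\<dots> \<longleftrightarrow> (\<exists>u\<in>cvec n. mv n C u = (\<lambda>_. 0) \<and> u \<noteq> (\<lambda>_. 0))"
  proof
    assume "\<exists>v. v \<in> carrier_vec n \<and> v \<noteq> 0\<^sub>v n \<and> ?C *\<^sub>v v = 0\<^sub>v n"
    then obtain v where v: "v \<in> carrier_vec n" "v \<noteq> 0\<^sub>v n" "?C *\<^sub>v v = 0\<^sub>v n" by blast
    let ?u = "\<lambda>k. if k < n then vec_index v k else 0"
    have "mv n C ?u k = 0" for k
    proof (cases "k < n")
      case True
      then have "mv n C ?u k = vec_index (?C *\<^sub>v v) k" using mult[OF v(1)] by simp
      then show ?thesis using v(3) True by simp
    qed (simp add: mv_def)
    moreover have "?u \<noteq> (\<lambda>_. 0)"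
    proof
      assume u0: "?u = (\<lambda>_. 0)"
      have "vec_index v k = 0" if "k < n" for k using fun_cong[OF u0, of k] that by simp
      then have "v = 0\<^sub>v n" using v(1) by (intro eq_vecI) auto
      with v(2) show False by simp
    qed
    ultimately show "\<exists>u\<in>cvec n. mv n C u = (\<lambda>_. 0) \<and> u \<noteq> (\<lambda>_. 0)"
      by (intro bexI[of _ ?u]) (auto simp: cvec_def)
  next
    assume "\<exists>u\<in>cvec n. mv n C u = (\<lambda>_. 0) \<and> u \<noteq> (\<lambda>_. 0)"
    then obtain u where u: "u \<in> cvec n" "mv n C u = (\<lambda>_. 0)" "u \<noteq> (\<lambda>_. 0)" by blast
    have "(\<lambda>k. if k < n then vec_index (Matrix.vec n u) k else 0) = u"
      using u(1) by (auto simp: cvec_def)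
    then have "?C *\<^sub>v Matrix.vec n u = 0\<^sub>v n"
      using mult[of "Matrix.vec n u"] u(2) by (auto intro!: eq_vecI)
    moreover have "Matrix.vec n u \<noteq> 0\<^sub>v n"
    proof
      assume "Matrix.vec n u = 0\<^sub>v n"
      then have "u k = 0" if "k < n" for k using that by (metis index_vec index_zero_vec(1))
      moreover have "u k = 0" if "\<not> k < n" for k using u(1) that by (simp add: cvec_def)
      ultimately show False using u(3) by blast
    qed
    ultimately show "\<exists>v. v \<in> carrier_vec n \<and> v \<noteq> 0\<^sub>v n \<and> ?C *\<^sub>v v = 0\<^sub>v n"
      by (intro exI[of _ "Matrix.vec n u"]) auto
  qed
  finally show ?thesis by blast
qed

text \<open>The adjoint is the entrywise conjugate of the transpose: conjugating vectors handles the
  first operation, invariance of the determinant the second.\<close>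

lemma injective_of_adj_injective:
  assumes inj: "\<And>u. u \<in> cvec n \<Longrightarrow> mv n (adj n C) u = (\<lambda>_. 0) \<Longrightarrow> u = (\<lambda>_. 0)"
    and u: "u \<in> cvec n" "mv n C u = (\<lambda>_. 0)"
  shows "u = (\<lambda>_. 0)"
proof -
  have "v = (\<lambda>_. 0)" if v: "v \<in> cvec n" "mv n (mtr C) v = (\<lambda>_. 0)" for v
  proof -
    have "mv n (adj n C) (\<lambda>k. cnj (v k)) k = cnj (mv n (mtr C) v k)" for k
      by (simp add: mv_def adj_def mtr_def)
    then have "mv n (adj n C) (\<lambda>k. cnj (v k)) = (\<lambda>_. 0)"
      by (simp add: v(2) fun_eq_iff)
    moreover have "(\<lambda>k. cnj (v k)) \<in> cvec n" using v(1) by (simp add: cvec_def)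
    ultimately have "(\<lambda>k. cnj (v k)) = (\<lambda>_. 0)" by (rule inj[rotated])
    then have "cnj (v k) = 0" for k by (rule fun_cong)
    then show ?thesis by auto
  qed
  then have "Determinant.det (Matrix.mat n n (\<lambda>(i, j). mtr C i j)) \<noteq> 0"
    using injective_iff_det[of n "mtr C"] by blast
  also have "Matrix.mat n n (\<lambda>(i, j). mtr C i j) = transpose_mat (Matrix.mat n n (\<lambda>(i, j). C i j))"
    by (auto simp: mtr_def intro!: eq_matI)
  also have "Determinant.det \<dots> = Determinant.det (Matrix.mat n n (\<lambda>(i, j). C i j))"
    by (rule Determinant.det_transpose[OF mat_carrier])
  finally show ?thesis using injective_iff_det[of n C] u by blast
qed

lemma adj_surjective:
  assumes inj: "\<And>u. u \<in> cvec n \<Longrightarrow> mv n C u = (\<lambda>_. 0) \<Longrightarrow> u = (\<lambda>_. 0)" and x: "x \<in> cvec n"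
  shows "\<exists>u\<in>cvec n. x = mv n (adj n C) u"
proof -
  obtain w u where "w \<in> ker n C" "u \<in> cvec n" "x = (\<lambda>k. w k + mv n (adj n C) u k)"
    using ker_ran_decomposition[OF x] by blast
  moreover from this have "w = (\<lambda>_. 0)" using inj by (auto simp: ker_def)
  ultimately show ?thesis by auto
qed

section \<open>Maximal isotropic boundary conditions\<close>

locale boundary_condition =
  fixes n :: nat and A B :: "nat \<Rightarrow> nat \<Rightarrow> complex"
  assumes rank: "{(\<lambda>k. mv n A x1 k + mv n B x2 k) | x1 x2. x1 \<in> cvec n \<and> x2 \<in> cvec n} = cvec n"
    and selfadj: "adj n (mm n A (adj n B)) = mm n A (adj n B)"
begin

lemma A_adj_B: "mv n A (mv n (adj n B) u) = mv n B (mv n (adj n A) u)"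
proof -
  have "mv n A (mv n (adj n B) u) = mv n (adj n (mm n A (adj n B))) u"
    by (simp add: selfadj mv_mm)
  then show ?thesis by (simp add: adj_mm mv_mm mv_adj_adj)
qed

lemma cinner_adj_A_adj_B:
  "cinner n (mv n (adj n A) u) (mv n (adj n B) v) = cinner n (mv n (adj n B) u) (mv n (adj n A) v)"
  by (simp add: cinner_adj' mv_adj_adj A_adj_B)

definition comb :: "complex \<Rightarrow> nat \<Rightarrow> nat \<Rightarrow> complex" where
  "comb c = (\<lambda>k l. A k l + c * B k l)"

lemma mv_comb: "mv n (comb c) x = (\<lambda>k. mv n A x k + c * mv n B x k)"
  by (auto simp: mv_def comb_def algebra_simps sum.distrib sum_distrib_left intro!: ext)

lemma mv_adj_comb: "mv n (adj n (comb c)) x = (\<lambda>k. mv n (adj n A) x k + cnj c * mv n (adj n B) x k)"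
  by (auto simp: mv_def adj_def comb_def algebra_simps sum.distrib sum_distrib_left intro!: ext)

text \<open>A kernel vector satisfies \<open>A\<^sup>\<dagger>u = c B\<^sup>\<dagger>u\<close>. For
  imaginary \<open>c\<close>, symmetry of \<open>A B\<^sup>\<dagger>\<close> then forces both sides
  to vanish, so \<open>u\<close> is orthogonal to the range of \<open>(A, B)\<close>, which is the
  whole space.\<close>

lemma adj_comb_injective:
  assumes c: "cnj c = - c" "c \<noteq> 0" and u: "u \<in> cvec n" "mv n (adj n (comb c)) u = (\<lambda>_. 0)"
  shows "u = (\<lambda>_. 0)"
proof -
  have A: "mv n (adj n A) u = (\<lambda>k. c * mv n (adj n B) u k)"
    using u(2) by (simp add: mv_adj_comb c(1) fun_eq_iff)
  have "cnj c * cinner n (mv n (adj n B) u) (mv n (adj n B) u) = c * cinner n (mv n (adj n B) u) (mv n (adj n B) u)"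
    using cinner_adj_A_adj_B[of u u] by (simp add: A cinner_simps)
  then have "cinner n (mv n (adj n B) u) (mv n (adj n B) u) = 0" using c by simp
  then have B0: "mv n (adj n B) u = (\<lambda>_. 0)" by (rule cinner_self_eq_0[OF cvec_mv])
  then have A0: "mv n (adj n A) u = (\<lambda>_. 0)" using A by simp
  obtain x1 x2 where "u = (\<lambda>k. mv n A x1 k + mv n B x2 k)"
    using u(1) rank by blast
  then have "cinner n u u = cinner n u (mv n A x1) + cinner n u (mv n B x2)"
    by (metis cinner_add_right)
  also have "\<dots> = 0" by (simp add: cinner_adj A0 B0 cinner_zero_left)
  finally show ?thesis by (rule cinner_self_eq_0[OF u(1)])
qed

lemma comb_injective:
  assumes "cnj c = - c" "c \<noteq> 0" "u \<in> cvec n" "mv n (comb c) u = (\<lambda>_. 0)"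
  shows "u = (\<lambda>_. 0)"
  using injective_of_adj_injective[OF adj_comb_injective[OF assms(1,2)]] assms(3,4) by blast

text \<open>The isotropic subspace of pairs \<open>(B\<^sup>\<dagger>u, -A\<^sup>\<dagger>u)\<close> is maximal because \<open>A \<plusminus> \<i>B\<close> are invertible.\<close>
lemma boundary_parametrization:
  assumes x: "x1 \<in> cvec n" "x2 \<in> cvec n" and eq: "\<And>k. mv n A x1 k + mv n B x2 k = 0"
  shows "\<exists>u\<in>cvec n. x1 = mv n (adj n B) u \<and> x2 = (\<lambda>k. - mv n (adj n A) u k)"
proof -
  have "\<exists>u'\<in>cvec n. (\<lambda>k. x1 k + \<i> * x2 k) = mv n (adj n (comb (- \<i>))) u'"
  proof (rule adj_surjective)
    show "(\<lambda>k. x1 k + \<i> * x2 k) \<in> cvec n" using x by (intro cvec_intros)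
    show "u = (\<lambda>_. 0)" if "u \<in> cvec n" "mv n (comb (- \<i>)) u = (\<lambda>_. 0)" for u
      using that by (intro comb_injective[of "- \<i>" u]) auto
  qed
  then obtain u' where u': "u' \<in> cvec n" "(\<lambda>k. x1 k + \<i> * x2 k) = mv n (adj n (comb (- \<i>))) u'"
    by blast
  \<comment> \<open>With this factor the pair
    \<open>(B\<^sup>\<dagger>u, - A\<^sup>\<dagger>u)\<close> has the same value of
    \<open>x1 + \<i> x2\<close> as the given pair. The difference thus satisfies
    \<open>y1 = - \<i> y2\<close>, and the boundary condition for it collapses to
    \<open>(A + \<i>B) y2 = 0\<close>.\<close>
  define u where "u = (\<lambda>k. \<i> * u' k)"
  define y1 where "y1 = (\<lambda>k. x1 k - mv n (adj n B) u k)"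
  define y2 where "y2 = (\<lambda>k. x2 k - (-1) * mv n (adj n A) u k)"
  have y: "y1 \<in> cvec n" "y2 \<in> cvec n" unfolding y1_def y2_def using x by (simp_all only: cvec_diff cvec_scale cvec_mv)
  have y1: "y1 = (\<lambda>k. (- \<i>) * y2 k)"
  proof
    fix k
    have "x1 k = mv n (adj n A) u' k + \<i> * mv n (adj n B) u' k - \<i> * x2 k"
      using fun_cong[OF u'(2), of k] by (simp add: mv_adj_comb eq_diff_eq)
    then show "y1 k = (- \<i>) * y2 k"
      by (simp add: y1_def y2_def u_def mv_scale algebra_simps)
  qed
  have "mv n A y1 k + mv n B y2 k = 0" for k
  proof -
    have "mv n A y1 k + mv n B y2 k = mv n A x1 k + mv n B x2 k
        - (mv n A (mv n (adj n B) u) k - mv n B (mv n (adj n A) u) k)"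
      unfolding y1_def y2_def mv_diff mv_scale by simp
    then show ?thesis by (simp add: eq A_adj_B)
  qed
  then have "\<i> * ((- \<i>) * mv n A y2 k + mv n B y2 k) = 0" for k
    unfolding y1 mv_scale by simp
  then have "mv n (comb \<i>) y2 = (\<lambda>_. 0)"
    by (simp add: mv_comb algebra_simps)
  then have "y2 = (\<lambda>_. 0)" using y(2) by (intro comb_injective[of \<i> y2]) auto
  then have "y1 = (\<lambda>_. 0)" "y2 = (\<lambda>_. 0)" using y1 by auto
  then have "x1 = mv n (adj n B) u" "x2 = (\<lambda>k. - mv n (adj n A) u k)"
    by (auto simp: y1_def y2_def fun_eq_iff add_eq_0_iff)
  moreover have "u \<in> cvec n" using u'(1) by (simp add: u_def cvec_scale)
  ultimately show ?thesis by blast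
qed

text \<open>The graph of \<open>L\<close>: since
  \<open>A B\<^sup>\<dagger>u = B A\<^sup>\<dagger>u\<close>, the vector in the range of
  \<open>B\<^sup>\<dagger>\<close> that \<open>B\<close> maps to \<open>A B\<^sup>\<dagger>u\<close>
  is the corresponding component of \<open>A\<^sup>\<dagger>u\<close>. The vector \<open>u\<close>
  need not be determined by \<open>x\<close>, hence a relation.\<close>

definition Lrel :: "(nat \<Rightarrow> complex) \<Rightarrow> (nat \<Rightarrow> complex) \<Rightarrow> bool" where
  "Lrel x y \<longleftrightarrow> (\<exists>w u w' u'. w \<in> ker n B \<and> u \<in> cvec n \<and> w' \<in> ker n B \<and> u' \<in> cvec n \<and>
     x = (\<lambda>k. w k + mv n (adj n B) u k) \<and> mv n (adj n A) u = (\<lambda>k. w' k + mv n (adj n B) u' k) \<and>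
     y = mv n (adj n B) u')"

lemma Lrel_cvec: "Lrel x y \<Longrightarrow> x \<in> cvec n \<and> y \<in> cvec n"
  by (auto simp: Lrel_def ker_def cvec_intros)

lemma Lrel_total: "x \<in> cvec n \<Longrightarrow> \<exists>y. Lrel x y"
proof -
  assume "x \<in> cvec n"
  then obtain w u where w: "w \<in> ker n B" "u \<in> cvec n" "x = (\<lambda>k. w k + mv n (adj n B) u k)"
    using ker_ran_decomposition by blast
  moreover obtain w' u' where "w' \<in> ker n B" "u' \<in> cvec n"
      "mv n (adj n A) u = (\<lambda>k. w' k + mv n (adj n B) u' k)"
    using ker_ran_decomposition[OF cvec_mv] by blast
  ultimately show "\<exists>y. Lrel x y" unfolding Lrel_def by blast
qed

lemma Lrel_add:
  assumes "Lrel x y" "Lrel x' y'" shows "Lrel (\<lambda>k. x k + x' k) (\<lambda>k. y k + y' k)"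
proof -
  obtain w u v t where 1: "w \<in> ker n B" "u \<in> cvec n" "v \<in> ker n B" "t \<in> cvec n"
     "x = (\<lambda>k. w k + mv n (adj n B) u k)" "mv n (adj n A) u = (\<lambda>k. v k + mv n (adj n B) t k)"
     "y = mv n (adj n B) t" using assms(1) unfolding Lrel_def by blast
  obtain w' u' v' t' where 2: "w' \<in> ker n B" "u' \<in> cvec n" "v' \<in> ker n B" "t' \<in> cvec n"
     "x' = (\<lambda>k. w' k + mv n (adj n B) u' k)" "mv n (adj n A) u' = (\<lambda>k. v' k + mv n (adj n B) t' k)"
     "y' = mv n (adj n B) t'" using assms(2) unfolding Lrel_def by blast
  show ?thesis
    unfolding Lrel_def
    by (rule exI[of _ "\<lambda>k. w k + w' k"], rule exI[of _ "\<lambda>k. u k + u' k"],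
        rule exI[of _ "\<lambda>k. v k + v' k"], rule exI[of _ "\<lambda>k. t k + t' k"])
      (simp add: 1 2 ker_add cvec_add mv_add algebra_simps)
qed

lemma Lrel_scale:
  assumes "Lrel x y" shows "Lrel (\<lambda>k. c * x k) (\<lambda>k. c * y k)"
proof -
  obtain w u v t where 1: "w \<in> ker n B" "u \<in> cvec n" "v \<in> ker n B" "t \<in> cvec n"
     "x = (\<lambda>k. w k + mv n (adj n B) u k)" "mv n (adj n A) u = (\<lambda>k. v k + mv n (adj n B) t k)"
     "y = mv n (adj n B) t" using assms unfolding Lrel_def by blast
  show ?thesis
    unfolding Lrel_def
    by (rule exI[of _ "\<lambda>k. c * w k"], rule exI[of _ "\<lambda>k. c * u k"],
        rule exI[of _ "\<lambda>k. c * v k"], rule exI[of _ "\<lambda>k. c * t k"])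
      (simp add: 1 ker_scale cvec_scale mv_scale algebra_simps)
qed

lemma cinner_adj_ker: "w \<in> ker n B \<Longrightarrow> cinner n (mv n (adj n B) u) w = 0"
  using ker_adj_orth[of w n B u] cinner_commute[of n "mv n (adj n B) u" w] by simp

text \<open>The components in the kernel of \<open>B\<close> are orthogonal to the range of its
  adjoint and drop out; what remains is the symmetry of \<open>A B\<^sup>\<dagger>\<close>.\<close>

lemma Lrel_sym:
  assumes "Lrel x y" "Lrel x' y'" shows "cinner n x y' = cinner n y x'"
proof -
  obtain w u v t where 1: "w \<in> ker n B" "v \<in> ker n B" 
     "x = (\<lambda>k. w k + mv n (adj n B) u k)" "mv n (adj n A) u = (\<lambda>k. v k + mv n (adj n B) t k)"
     "y = mv n (adj n B) t" using assms(1) unfolding Lrel_def by blast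
  obtain w' u' v' t' where 2: "w' \<in> ker n B" "v' \<in> ker n B"
     "x' = (\<lambda>k. w' k + mv n (adj n B) u' k)" "mv n (adj n A) u' = (\<lambda>k. v' k + mv n (adj n B) t' k)"
     "y' = mv n (adj n B) t'" using assms(2) unfolding Lrel_def by blast
  have "cinner n x y' = cinner n (mv n (adj n B) u) (mv n (adj n B) t')"
    unfolding 1(3) 2(5) cinner_add_left using ker_adj_orth[OF 1(1)] by simp
  also have "\<dots> = cinner n (mv n (adj n B) u) (mv n (adj n A) u')"
    unfolding 2(4) cinner_add_right using cinner_adj_ker[OF 2(2)] by simp
  also have "\<dots> = cinner n (mv n (adj n A) u) (mv n (adj n B) u')"
    by (rule cinner_adj_A_adj_B[symmetric])
  also have "\<dots> = cinner n y (mv n (adj n B) u')"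
    unfolding 1(4,5) cinner_add_left using ker_adj_orth[OF 1(2)] by simp
  also have "\<dots> = cinner n y x'"
    unfolding 1(5) 2(3) cinner_add_right using cinner_adj_ker[OF 2(1)] by simp
  finally show ?thesis .
qed

lemma orth_proj_ker:
  assumes "w \<in> ker n B"
  shows "orth_proj n (ker n B) (\<lambda>k. w k + mv n (adj n B) u k) = w"
  unfolding orth_proj_def
proof (rule the_equality)
  show "w \<in> ker n B \<and> (\<forall>v\<in>ker n B. cinner n v (\<lambda>k. w k + mv n (adj n B) u k - w k) = 0)"
    using assms by (auto simp: ker_adj_orth)
  fix p assume p: "p \<in> ker n B \<and> (\<forall>v\<in>ker n B. cinner n v (\<lambda>k. w k + mv n (adj n B) u k - p k) = 0)"
  define q where "q = (\<lambda>k. w k - p k)"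
  have q: "q \<in> ker n B" unfolding q_def using assms p by (intro ker_diff) auto
  have "cinner n q (\<lambda>k. q k + mv n (adj n B) u k) = 0"
    using p q by (simp add: q_def algebra_simps)
  then have "cinner n q q = 0" using ker_adj_orth[OF q] by (simp add: cinner_add_right)
  then have "q = (\<lambda>_. 0)" using q by (intro cinner_self_eq_0) (auto simp: ker_def)
  then show "p = w" by (simp add: q_def fun_eq_iff)
qed

text \<open>The definite description has at most one candidate because the kernel of
  \<open>B\<close> and the range of its adjoint meet only in 0.\<close>

lemma Lop_eq:
  assumes "Lrel x y" shows "Lop n A B x = y"
proof -
  obtain w u v t where 1: "w \<in> ker n B" "u \<in> cvec n" "v \<in> ker n B" "t \<in> cvec n"
     "x = (\<lambda>k. w k + mv n (adj n B) u k)" "mv n (adj n A) u = (\<lambda>k. v k + mv n (adj n B) t k)"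
     "y = mv n (adj n B) t" using assms unfolding Lrel_def by blast
  have proj: "(\<lambda>k. x k - orth_proj n (ker n B) x k) = mv n (adj n B) u"
    unfolding 1(5) orth_proj_ker[OF 1(1)] by simp
  have "mv n B (mv n (adj n A) u) = (\<lambda>k. mv n B v k + mv n B y k)"
    unfolding 1(6,7) mv_add ..
  then have By: "mv n B y = mv n A (mv n (adj n B) u)"
    using 1(3) by (simp add: A_adj_B ker_def)
  show ?thesis
    unfolding Lop_def proj
  proof (rule the_equality)
    show "y \<in> ran n (adj n B) \<and> mv n B y = mv n A (mv n (adj n B) u)"
      using By 1(4,7) by (auto simp: ran_def)
    fix z assume z: "z \<in> ran n (adj n B) \<and> mv n B z = mv n A (mv n (adj n B) u)"
    then obtain t' where t': "z = mv n (adj n B) t'" by (auto simp: ran_def)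
    define q where "q = (\<lambda>k. z k - y k)"
    have "q \<in> ker n B" using z By 1(7) t' by (auto simp: q_def ker_def cvec_intros mv_diff)
    moreover have "q = mv n (adj n B) (\<lambda>k. t' k - t k)" by (simp add: q_def t' 1(7) mv_diff)
    ultimately have "cinner n q q = 0" using ker_adj_orth by metis
    then have "q = (\<lambda>_. 0)" using \<open>q \<in> ker n B\<close> by (intro cinner_self_eq_0) (auto simp: ker_def)
    then show "z = y" by (simp add: q_def fun_eq_iff)
  qed
qed

text \<open>The matrix obtained from the symmetric relation has the same columns as
  \<open>Lmat\<close>, which thereby inherits its properties.\<close>

lemma Lmat_hermitian: "hermitian n (Lmat n A B)"
  and Lmat_eq: "Lrel x y \<Longrightarrow> mv n (Lmat n A B) x = y"
proof -
  have "\<exists>M. hermitian n M \<and> (\<forall>x\<in>cvec n. Lrel x (mv n M x))"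
    using Lrel_cvec Lrel_total Lrel_add Lrel_scale Lrel_sym by (rule symmetric_relation_matrix)
  then obtain M where M: "hermitian n M" "\<forall>x\<in>cvec n. Lrel x (mv n M x)" by blast
  have "Lmat n A B k l = M k l" for k l
  proof (cases "k < n \<and> l < n")
    case True
    then have "Lop n A B (std_vec l) = mv n M (std_vec l)"
      using M(2) std_vec_cvec Lop_eq by blast
    with True show ?thesis by (simp add: Lmat_def std_vec_def[symmetric] mv_std_vec)
  next
    case False
    then have "M k l = 0" using M(1) unfolding hermitian_def cmat_def by (auto simp: not_less)
    with False show ?thesis by (auto simp: Lmat_def)
  qed
  then have "Lmat n A B = M" by blast
  then show "hermitian n (Lmat n A B)" "Lrel x y \<Longrightarrow> mv n (Lmat n A B) x = y"
    using M Lop_eq Lrel_cvec by metis+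
qed

theorem boundary_form_bound:
  assumes x: "x1 \<in> cvec n" "x2 \<in> cvec n" and eq: "\<And>k. mv n A x1 k + mv n B x2 k = 0"
  shows "- opnorm n (pos_part n (Lmat n A B)) * (vnorm n x1)\<^sup>2 \<le> Re (cinner n x1 x2)"
proof -
  obtain u where u: "u \<in> cvec n" "x1 = mv n (adj n B) u" "x2 = (\<lambda>k. - mv n (adj n A) u k)"
    using boundary_parametrization[OF x eq] by blast
  obtain v t where v: "v \<in> ker n B" "t \<in> cvec n" "mv n (adj n A) u = (\<lambda>k. v k + mv n (adj n B) t k)"
    using ker_ran_decomposition[OF cvec_mv] by blast
  have zero: "(\<lambda>_. 0) \<in> ker n B" by (simp add: ker_def cvec_zero mv_zero)
  \<comment> \<open>\<open>x1\<close> has no component in the kernel of \<open>B\<close>, so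
    \<open>u\<close> itself can be used in \<open>Lrel\<close>.\<close>
  have "x1 = (\<lambda>k. 0 + mv n (adj n B) u k)" using u(2) by simp
  then have "Lrel x1 (mv n (adj n B) t)"
    unfolding Lrel_def using u(1) v zero by blast
  then have L: "mv n (Lmat n A B) x1 = mv n (adj n B) t" by (rule Lmat_eq)
  have "cinner n x1 x2 = - cinner n x1 (mv n (adj n A) u)"
    unfolding u(3) cinner_minus_right ..
  \<comment> \<open>The component \<open>v\<close> of \<open>A\<^sup>\<dagger>u\<close> in the
    kernel of \<open>B\<close> is orthogonal to \<open>x1\<close>.\<close>
  also have "cinner n x1 (mv n (adj n A) u) = cinner n x1 (mv n (Lmat n A B) x1)"
    unfolding L v(3) cinner_add_right by (simp add: u(2) cinner_adj_ker[OF v(1)])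
  finally show ?thesis
    using quadratic_form_le_pos_part[OF Lmat_hermitian x(1)] by simp
qed

end

section \<open>The lower bound\<close>

lemma sum_lessThan_add: "(\<Sum>k<m + l. f k) = (\<Sum>k<m. f k) + (\<Sum>i<l. f (m + i))"
  for f :: "nat \<Rightarrow> 'a::comm_monoid_add"
  by (induction l) (simp_all add: ac_simps)

text \<open>Regroups the boundary coordinates by edges: the start points of all edges come first,
  then the end points of the internal ones, whose sign in \<open>bder\<close> produces the
  subtraction.\<close>

lemma boundary_sums:
  fixes a :: "nat \<Rightarrow> real"
  shows "cinner (nE + 2 * nI) (bval nE nI a \<psi>) (bder nE nI a d) =
      (\<Sum>j<nE. cnj (\<psi> j 0) * d j 0)
      + (\<Sum>i<nI. cnj (\<psi> (nE + i) 0) * d (nE + i) 0 - cnj (\<psi> (nE + i) (a i)) * d (nE + i) (a i))"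
    "(vnorm (nE + 2 * nI) (bval nE nI a \<psi>))\<^sup>2 =
      (\<Sum>j<nE. (cmod (\<psi> j 0))\<^sup>2) + (\<Sum>i<nI. (cmod (\<psi> (nE + i) 0))\<^sup>2 + (cmod (\<psi> (nE + i) (a i)))\<^sup>2)"
proof -
  have n: "nE + 2 * nI = (nE + nI) + nI" by simp
  show "cinner (nE + 2 * nI) (bval nE nI a \<psi>) (bder nE nI a d) =
      (\<Sum>j<nE. cnj (\<psi> j 0) * d j 0)
      + (\<Sum>i<nI. cnj (\<psi> (nE + i) 0) * d (nE + i) 0 - cnj (\<psi> (nE + i) (a i)) * d (nE + i) (a i))"
    unfolding cinner_def n sum_lessThan_add by (simp add: bval_def bder_def sum_subtractf sum_negf)
  have "(vnorm (nE + 2 * nI) (bval nE nI a \<psi>))\<^sup>2 = (\<Sum>k<nE + 2 * nI. (cmod (bval nE nI a \<psi> k))\<^sup>2)"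
    by (simp add: vnorm_def sum_nonneg)
  then show "(vnorm (nE + 2 * nI) (bval nE nI a \<psi>))\<^sup>2 =
      (\<Sum>j<nE. (cmod (\<psi> j 0))\<^sup>2) + (\<Sum>i<nI. (cmod (\<psi> (nE + i) 0))\<^sup>2 + (cmod (\<psi> (nE + i) (a i)))\<^sup>2)"
    unfolding n sum_lessThan_add by (simp add: bval_def sum.distrib)
qed

theorem theorem3p10:
  fixes nE nI :: nat and a :: "nat \<Rightarrow> real" and A B :: "nat \<Rightarrow> nat \<Rightarrow> complex"
    and \<psi> d g :: "nat \<Rightarrow> real \<Rightarrow> complex"
  defines "n \<equiv> nE + 2 * nI"
  assumes I_nonempty: "0 < nI"
    and a_pos: "\<forall>i<nI. 0 < a i"
    and AB_rank: "{(\<lambda>k. mv n A x1 k + mv n B x2 k) | x1 x2. x1 \<in> cvec n \<and> x2 \<in> cvec n} = cvec n"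
    and AB_selfadj: "adj n (mm n A (adj n B)) = mm n A (adj n B)"
    and dom: "\<forall>j < nE + nI. edge_H2 (edge_interval nE a j) (\<psi> j) (d j) (g j)"
    and bc: "\<forall>k<n. mv n A (bval nE nI a \<psi>) k + mv n B (bder nE nI a d) k = 0"
  shows "Re (\<Sum>j < nE + nI. integral\<^sup>L (lebesgue_on (edge_interval nE a j))
              (\<lambda>x. cnj (\<psi> j x) * (- g j x)))
     \<ge> - (s_sol (Min (a ` {..<nI})) (opnorm n (pos_part n (Lmat n A B))))\<^sup>2
         * (\<Sum>j < nE + nI. integral\<^sup>L (lebesgue_on (edge_interval nE a j))
              (\<lambda>x. (cmod (\<psi> j x))\<^sup>2))"
proof -
  define t where "t = opnorm n (pos_part n (Lmat n A B))"
  define amin where "amin = Min (a ` {..<nI})"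
  define s where "s = s_sol amin t"
  define x1 where "x1 = bval nE nI a \<psi>"
  define x2 where "x2 = bder nE nI a d"
  have "amin \<in> a ` {..<nI}" unfolding amin_def using I_nonempty by (intro Min_in) auto
  then have "0 < amin" using a_pos by auto
  then have s: "0 \<le> s" "s * tanh (amin * s / 2) = t"
    unfolding s_def using s_sol_properties opnorm_nonneg[of n] by (simp_all add: t_def)
  \<comment> \<open>External edges offer the coefficient \<open>s\<close>, which suffices because
    tanh stays below 1.\<close>
  have t_le_s: "t \<le> s"
    unfolding s(2)[symmetric] using s(1) tanh_real_lt_1[of "amin * s / 2"] by (intro mult_left_le) auto
  \<comment> \<open>tanh is increasing, so the shortest internal edge has the smallest coefficient;
    this is why the minimal length defines \<open>s\<close>.\<close>
  have t_le_tanh: "t \<le> s * tanh (a i * s / 2)" if "i < nI" for i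
  proof -
    have "amin \<le> a i" unfolding amin_def using that by (intro Min_le) auto
    then show ?thesis
      unfolding s(2)[symmetric] using s(1) by (intro mult_left_mono) (auto intro: mult_right_mono)
  qed
  \<comment> \<open>The contribution of edge \<open>j\<close> to the quadratic form of
    \<open>-\<Delta>\<close> + \<open>s\<^sup>2\<close>; the claim is that these add up to a
    nonnegative number.\<close>
  define form where "form j = Re (integral\<^sup>L (lebesgue_on (edge_interval nE a j)) (\<lambda>x. cnj (\<psi> j x) * (- g j x)))
      + s\<^sup>2 * integral\<^sup>L (lebesgue_on (edge_interval nE a j)) (\<lambda>x. (cmod (\<psi> j x))\<^sup>2)" for j
  have ext: "Re (cnj (\<psi> j 0) * d j 0) + t * (cmod (\<psi> j 0))\<^sup>2 \<le> form j" if "j < nE" for j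
  proof -
    have "edge_H2 {0..} (\<psi> j) (d j) (g j)"
      using dom[rule_format, of j] that by (simp add: edge_interval_def)
    from external_edge_estimate[OF this s(1)]
    have "Re (cnj (\<psi> j 0) * d j 0) + s * (cmod (\<psi> j 0))\<^sup>2 \<le> form j"
      using that by (simp add: form_def edge_interval_def)
    then show ?thesis
      using mult_right_mono[OF t_le_s, of "(cmod (\<psi> j 0))\<^sup>2"] by simp
  qed
  have int: "Re (cnj (\<psi> (nE + i) 0) * d (nE + i) 0 - cnj (\<psi> (nE + i) (a i)) * d (nE + i) (a i))
      + t * ((cmod (\<psi> (nE + i) 0))\<^sup>2 + (cmod (\<psi> (nE + i) (a i)))\<^sup>2) \<le> form (nE + i)" if "i < nI" for i
  proof -
    have "edge_H2 {0..a i} (\<psi> (nE + i)) (d (nE + i)) (g (nE + i))"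
      using dom[rule_format, of "nE + i"] that by (simp add: edge_interval_def)
    note est = internal_edge_estimate[OF this _ s(1)]
    show ?thesis
      using est a_pos that mult_right_mono[OF t_le_tanh[OF that],
          of "(cmod (\<psi> (nE + i) 0))\<^sup>2 + (cmod (\<psi> (nE + i) (a i)))\<^sup>2"]
      by (simp add: form_def edge_interval_def less_imp_le del: mult_minus_right)
  qed
  interpret boundary_condition n A B
    by unfold_locales (fact AB_rank, fact AB_selfadj)
  have x: "x1 \<in> cvec n" "x2 \<in> cvec n"
    by (auto simp: x1_def x2_def n_def bval_def bder_def cvec_def)
  have "mv n A x1 k + mv n B x2 k = 0" for k
    using bc unfolding x1_def x2_def by (cases "k < n") (auto simp: mv_def)
  then have "0 \<le> Re (cinner n x1 x2) + t * (vnorm n x1)\<^sup>2"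
    using boundary_form_bound[OF x] by (simp add: t_def)
  \<comment> \<open>The coefficient \<open>t\<close> is distributed over the single boundary values,
    so that each edge can be compared with its own share.\<close>
  also have "\<dots> = (\<Sum>j<nE. Re (cnj (\<psi> j 0) * d j 0) + t * (cmod (\<psi> j 0))\<^sup>2)
      + (\<Sum>i<nI. Re (cnj (\<psi> (nE + i) 0) * d (nE + i) 0 - cnj (\<psi> (nE + i) (a i)) * d (nE + i) (a i))
          + t * ((cmod (\<psi> (nE + i) 0))\<^sup>2 + (cmod (\<psi> (nE + i) (a i)))\<^sup>2))"
    unfolding x1_def x2_def n_def boundary_sums sum.distrib sum_distrib_left[symmetric] plus_complex.sel Re_sum
    by (simp only: distrib_left ac_simps)
  also have "\<dots> \<le> (\<Sum>j<nE. form j) + (\<Sum>i<nI. form (nE + i))"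
    by (intro add_mono sum_mono ext int) auto
  also have "\<dots> = (\<Sum>j<nE + nI. form j)"
    by (rule sum_lessThan_add[symmetric])
  finally have "0 \<le> (\<Sum>j<nE + nI. form j)" .
  then show ?thesis
    unfolding form_def sum.distrib sum_distrib_left[symmetric] Re_sum s_def t_def amin_def by linarith
qed

end
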